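(* Let $p\ge1$ and let $n,s$ be integers with $0\le n\le p$, $0\le s\le p-1$ and $\kappa:=s-n\ge-2$. Let $\mathbf{a}_1\in(\mathbb{C}\setminus\mathbb{Z})^{n}$, $\mathbf{a}_2\in\mathbb{C}^{p-n}$, $\mathbf{a}=(\mathbf{a}_1,\mathbf{a}_2)\in\mathbb{C}^{p}$, $\mathbf{b}_1\in(\mathbb{C}\setminus\mathbb{Z})^{s}$, $\mathbf{b}_2\in\mathbb{C}^{p-1-s}$, $\mathbf{b}=(\mathbf{b}_1,\mathbf{b}_2)\in\mathbb{C}^{p-1}$, assume $\Re\big(\sum_{b\in\mathbf{b}}b-\sum_{a\in\mathbf{a}}a\big)>0$, and assume the parameters are generic (components of $\mathbf{a}_2$ non-integer and pairwise distinct modulo $\mathbb{Z}$, components of $\mathbf{b}_1$ pairwise distinct modulo $\mathbb{Z}$, and more generally all Gamma factors below finite). Let $z=(-1)^{\kappa}$. Then \begin{multline*} \sum_{k=0}^{\infty}\frac{(\mathbf{a})_{k}z^{k}}{\pi(\mathbf{b})_{k}k!}\Big[\sum_{b\in\mathbf{b}}\psi(b+k)+\psi(1+k)-\sum_{a\in\mathbf{a}}\psi(a+k)\Big] =\Big\{\sum_{a\in\mathbf{a}_1}\cot(\pi a)-\sum_{b\in\mathbf{b}_1}\cot(\pi b)\Big\}{}_{p}F_{p-1}\!\left(\left.\begin{matrix}\mathbf{a}\\\mathbf{b}\end{matrix}\right|z\right)\\ -\frac{z\,(1-\mathbf{b})_{1}}{\pi(1-\mathbf{a})_{1}}\,{}_{p+1}F_{p}\!\left(\left.\begin{matrix}1,1,2-\mathbf{b}\\2-\mathbf{a}\end{matrix}\right|z\right)\\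 +\frac{\Gamma(1-\mathbf{a}_1)\Gamma(\mathbf{b}_2)}{\Gamma(1-\mathbf{b}_1)\Gamma(\mathbf{a}_2)}\sum_{a_k\in\mathbf{a}_2}\frac{\Gamma(a_k)\Gamma(\mathbf{a}_{2[k]}-a_k)\Gamma(1-\mathbf{b}_1+a_k)}{\sin(\pi a_k)\Gamma(\mathbf{b}_2-a_k)\Gamma(1-\mathbf{a}_1+a_k)}\,{}_{p}F_{p-1}\!\left(\left.\begin{matrix}a_k,\,1-\mathbf{b}+a_k\\1-\mathbf{a}_{[k]}+a_k\end{matrix}\right|z\right)\\ +\frac{\Gamma(1-\mathbf{a}_1)\Gamma(\mathbf{b}_2)}{\Gamma(1-\mathbf{b}_1)\Gamma(\mathbf{a}_2)}\sum_{b_k\in\mathbf{b}_1}\frac{\Gamma(b_k-1)\Gamma(b_k-\mathbf{b}_{1[k]})\Gamma(1-b_k+\mathbf{a}_2)}{\sin(\pi b_k)\Gamma(b_k-\mathbf{a}_1)\Gamma(1-b_k+\mathbf{b}_2)}\,{}_{p}F_{p-1}\!\left(\left.\begin{matrix}1-b_k+\mathbf{a}\\2-b_k,\,1-b_k+\mathbf{b}_{[k]}\end{matrix}\right|z\right). \end{multline*} Here, for $a_k\in\mathbf{a}_2$, $\mathbf{a}_{2[k]}$ and $\mathbf{a}_{[k]}$ denote $\mathbf{a}_2$, resp. $\mathbf{a}$, with that component $a_k$ removed; similarly for $b_k\in\mathbf{b}_1$, $\mathbf{b}_{1[k]}$ and $\mathbf{b}_{[k]}$ denote $\mathbf{b}_1$,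 resp. $\mathbf{b}$, with $b_k$ removed.
   Context: $\psi=\Gamma'/\Gamma$ is the digamma function and $(x)_k=\Gamma(x+k)/\Gamma(x)$ the Pochhammer symbol. For a vector $\mathbf{a}=(a_1,\dots,a_q)$ and scalar $\beta$: $\Gamma(\mathbf{a})=\prod_i\Gamma(a_i)$ (empty product $=1$), $(\mathbf{a})_k=\prod_i(a_i)_k$, $\mathbf{a}+\beta=(a_1+\beta,\dots,a_q+\beta)$, $\beta-\mathbf{a}=(\beta-a_1,\dots,\beta-a_q)$, $\mathbf{a}_{[k]}$ is $\mathbf{a}$ with the $k$-th component removed, and $\sum_{a\in\mathbf{a}}$ runs over the components of $\mathbf{a}$. ${}_pF_q(\mathbf{a};\mathbf{b};z)=\sum_{k\ge0}\frac{(\mathbf{a})_k}{(\mathbf{b})_k}\frac{z^k}{k!}$. Listing several vectors/scalars separated by commas in a parameter row means concatenation. *)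

theory Defs
  imports "HOL-Analysis.Analysis"
begin

definition pochL :: "complex list \<Rightarrow> nat \<Rightarrow> complex" where
  "pochL xs k = (\<Prod>x\<leftarrow>xs. pochhammer x k)"

definition GammaL :: "complex list \<Rightarrow> complex" where
  "GammaL xs = (\<Prod>x\<leftarrow>xs. Gamma x)"

definition hypF :: "complex list \<Rightarrow> complex list \<Rightarrow> complex \<Rightarrow> complex" where
  "hypF as bs z = (\<Sum>k. pochL as k / pochL bs k * z ^ k / of_nat (fact k))"

definition del_nth :: "nat \<Rightarrow> 'a list \<Rightarrow> 'a list" where
  "del_nth i xs = take i xs @ drop (Suc i) xs"

end

(* The function
     G(t) = Gamma(a2 + t) Gamma(1 - b1 - t) Gamma(-t)^2 Gamma(1 + t) / (Gamma(1 - a1 - t) Gamma(b2 + t))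
   has a double pole at every t = k >= 0, where its residue is the k-th term of the digamma series
   plus cotangents times the k-th hypergeometric term, and simple poles at t = -1 - k,
   t = -a_i - k (a_i in a2) and t = 1 - b_i + k (b_i in b1), whose residues are the terms of the
   other hypergeometric series.  By the reflection formula G is a quotient of Gamma functions of
   order |t|^(Re(sum a - sum b) - 1) times a quotient of sines which, because s - n >= -2, is bounded
   on rectangles whose vertical sides keep a fixed distance from the poles.  Hence the integrals
   over growing rectangles tend to 0 and the sum of all residues vanishes.  The value
   z = (-1)^(s - n) comes from the signs picked up by the sines under integer shifts. *)

theory Submission
  imports Defs "HOL-Complex_Analysis.Complex_Analysis" "HOL-Library.Landau_Symbols"
begin

section \<open>Shift asymptotics of the Gamma function\<close>

text \<open>All estimates are reduced to the closed right half-plane and to the ratio Gamma(x + t) /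
  Gamma(t). Factors with argument 1 - x - t are reflected first, and points with Re t < 0 are
  treated after t -> -t. Each factor then has a size |t|^alpha |Gamma t|^m exp(pi |Im t|)^e, so that
  only three exponents have to be added up. The exponents m cancel because there is one more upper
  than lower parameter; e becomes n - s - 2 in both half-planes; and alpha < -1 beats the perimeter,
  which is of order N. All series live on the circle |z| = 1. Convergence of the digamma series is a
  result, not an input: the other series converge absolutely, the N-th rectangle encloses exactly
  the double poles 0, ..., N, and so the partial sums of the double-pole residues are forced to
  converge. The digammas appear because the residue at a double pole is a derivative, and the
  derivative of a product of Gamma factors is the product times a sum of logarithmic
  derivatives.\<close>

lemma norm_Ln_binomial_quotient_le:
  fixes x u :: complex
  assumes "norm u \<le> 1/2" "norm (x * u) \<le> 1/2"
  shows "norm (x * Ln (1 + u) - Ln (1 + x * u)) \<le> 2 * (norm x + (norm x)\<^sup>2) * (norm u)\<^sup>2"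
proof -
  have *: "norm (Ln (1 + v) - v) \<le> 2 * (norm v)\<^sup>2" if "norm v \<le> 1/2" for v :: complex
  proof -
    have "norm (Ln (1 + v) - v) \<le> (norm v)\<^sup>2 / (1 - norm v)"
      using Ln_approx_linear[of v] that by simp
    also have "\<dots> \<le> (norm v)\<^sup>2 / (1/2)"
      using that by (intro divide_left_mono) auto
    finally show ?thesis by simp
  qed
  \<comment> \<open>The first-order terms x u of the two logarithms cancel, so that only two
    quadratic Taylor remainders are left.\<close>
  have "norm (x * Ln (1 + u) - Ln (1 + x * u))
      = norm (x * (Ln (1 + u) - u) - (Ln (1 + x * u) - x * u))"
    by (simp add: algebra_simps)
  also have "\<dots> \<le> norm x * norm (Ln (1 + u) - u) + norm (Ln (1 + x * u) - x * u)"
    by (metis norm_mult norm_triangle_ineq4)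
  also have "\<dots> \<le> norm x * (2 * (norm u)\<^sup>2) + 2 * (norm (x * u))\<^sup>2"
    using assms by (intro add_mono mult_left_mono *) auto
  finally show ?thesis by (simp add: norm_mult power_mult_distrib algebra_simps)
qed

text \<open>No branch jump occurs: in absolute value the argument of t is at most pi/2 and that of 1
  + 1/t strictly less than pi/2, so their sum stays inside the principal strip.\<close>

lemma Ln_add_one:
  assumes "Re t \<ge> 0" "t \<noteq> 0"
  shows "Ln (t + 1) = Ln t + Ln (1 + 1 / t)"
proof -
  have "Re (1 / t) \<ge> 0"
    using assms by (simp add: Re_divide)
  hence pos: "Re (1 + 1 / t) > 0" by simp
  hence "1 + 1 / t \<noteq> 0" by (metis less_irrefl zero_complex.simps(1))
  moreover have "\<bar>Im (Ln (1 + 1 / t))\<bar> < pi/2"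
    using pos by (rule Re_Ln_pos_lt_imp)
  moreover have "\<bar>Im (Ln t)\<bar> \<le> pi/2"
    using assms Re_Ln_pos_le by blast
  moreover have "t + 1 = t * (1 + 1 / t)"
    using assms by (simp add: field_simps)
  ultimately show ?thesis
    using assms(2) Ln_times[of t "1 + 1 / t"] by (auto simp: abs_le_iff abs_less_iff)
qed

lemma sum_Ln_telescope:
  assumes "Re t \<ge> 0" "t \<noteq> 0"
  shows "(\<Sum>k<n. Ln (1 + 1 / (t + of_nat k))) = Ln (t + of_nat n) - Ln t"
proof (induction n)
  case (Suc n)
  have "t + of_nat n \<noteq> 0"
    using assms by (cases "n = 0") (auto simp: complex_eq_iff)
  hence "Ln (t + of_nat n + 1) = Ln (t + of_nat n) + Ln (1 + 1 / (t + of_nat n))"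
    using assms by (intro Ln_add_one) auto
  thus ?case using Suc by (simp add: algebra_simps)
qed auto

lemma norm_add_of_nat_ge:
  assumes "Re t \<ge> 0"
  shows "norm (t + of_nat k) \<ge> norm t" "norm (t + of_nat k) \<ge> real k"
proof -
  show "norm (t + of_nat k) \<ge> norm t"
    using assms by (auto simp: cmod_def power2_eq_square intro!: real_sqrt_le_mono mult_mono add_mono)
  have "real k \<le> Re (t + of_nat k)" using assms by simp
  also have "\<dots> \<le> norm (t + of_nat k)" by (rule complex_Re_le_cmod)
  finally show "norm (t + of_nat k) \<ge> real k" .
qed

text \<open>Both sides of the identity are Gauss products; by telescoping of \<open>Ln (t + k)\<close> their
  quotient involves only the second-order quantities \<open>x Ln (1 + u) - Ln (1 + x u)\<close> with
  \<open>u = 1 / (t + k)\<close>, whose sum over \<open>k\<close> is bounded uniformly in \<open>t\<close>.\<close>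

lemma rGamma_series_quotient:
  fixes x t :: complex
  assumes t: "Re t \<ge> 0" "norm t \<ge> 2" "norm t \<ge> 2 * norm x"
  defines "e \<equiv> (\<lambda>k. x * Ln (1 + 1 / (t + of_nat k)) - Ln (1 + x * (1 / (t + of_nat k))))"
  shows "rGamma_series (x + t) n * exp (x * Ln t) =
           rGamma_series t n * exp (x * (Ln (t + of_nat (Suc n)) - of_real (ln (real n))) - (\<Sum>k\<le>n. e k))"
proof -
  have nz: "t + of_nat k \<noteq> 0" "1 + x * (1 / (t + of_nat k)) \<noteq> 0" for k
  proof -
    have n: "norm (t + of_nat k) \<ge> 2" "norm (t + of_nat k) \<ge> 2 * norm x"
      using norm_add_of_nat_ge[OF t(1), of k] t by linarith+
    thus "t + of_nat k \<noteq> 0" by auto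
    have "norm (x * (1 / (t + of_nat k))) \<le> 1/2"
      using n by (simp add: norm_divide norm_mult divide_le_eq)
    thus "1 + x * (1 / (t + of_nat k)) \<noteq> 0"
      by (metis add.commute add_eq_0_iff le_divide_eq_1_pos norm_minus_cancel norm_one not_less
          numeral_le_one_iff semiring_norm(69) zero_less_numeral)
  qed
  have "pochhammer (x + t) (Suc n) = (\<Prod>k\<le>n. x + t + of_nat k)"
    by (simp add: pochhammer_prod lessThan_Suc_atMost atLeast0LessThan)
  also have "\<dots> = (\<Prod>k\<le>n. (t + of_nat k) * (1 + x * (1 / (t + of_nat k))))"
    using nz by (intro prod.cong) (auto simp: field_simps)
  also have "\<dots> = (\<Prod>k\<le>n. t + of_nat k) * (\<Prod>k\<le>n. 1 + x * (1 / (t + of_nat k)))"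
    by (rule prod.distrib)
  also have "(\<Prod>k\<le>n. t + of_nat k) = pochhammer t (Suc n)"
    by (simp add: pochhammer_prod lessThan_Suc_atMost atLeast0LessThan)
  also have "(\<Prod>k\<le>n. 1 + x * (1 / (t + of_nat k))) = (\<Prod>k\<le>n. exp (x * Ln (1 + 1 / (t + of_nat k)) - e k))"
    using nz by (intro prod.cong) (auto simp: e_def)
  also have "\<dots> = exp (x * (\<Sum>k\<le>n. Ln (1 + 1 / (t + of_nat k))) - (\<Sum>k\<le>n. e k))"
    by (simp add: exp_sum[symmetric] sum_subtractf sum_distrib_left)
  also have "(\<Sum>k\<le>n. Ln (1 + 1 / (t + of_nat k))) = Ln (t + of_nat (Suc n)) - Ln t"
    using sum_Ln_telescope[of t "Suc n"] t nz(1)[of 0] by (simp add: lessThan_Suc_atMost del: sum.lessThan_Suc)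
  finally have *: "pochhammer (x + t) (Suc n) = pochhammer t (Suc n) *
      exp (x * (Ln (t + of_nat (Suc n)) - Ln t) - (\<Sum>k\<le>n. e k))" .
  show ?thesis
    unfolding rGamma_series_def using * 
    by (simp add: field_simps exp_diff exp_add exp_of_real flip: exp_minus)
qed

text \<open>A weak form of Stirling: up to constants, Gamma(x + t) / Gamma(t) has size |t|^(Re x),
  uniformly up to the imaginary axis. It is stated multiplicatively for the entire function
  \<open>rGamma\<close>; the two inequalities later bound \<open>rGamma (x + t)\<close> and
  \<open>Gamma (x + t)\<close> respectively.\<close>

lemma Gamma_shift_asymp:
  fixes x :: complex
  obtains C K where "C > 0" "K \<ge> 2"
    "\<And>t. Re t \<ge> 0 \<Longrightarrow> norm t \<ge> K \<Longrightarrow>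
       norm (rGamma (x + t)) * norm t powr Re x \<le> C * norm (rGamma t) \<and>
       norm (rGamma t) \<le> C * (norm (rGamma (x + t)) * norm t powr Re x)"
proof -
  \<comment> \<open>For norm t >= K both u = 1/(t + k) and x u have norm at most 1/2, as the
    logarithm estimate requires.\<close>
  define K where "K = max 2 (2 * norm x)"
  define S where "S = (\<Sum>k. inverse (real (Suc k) ^ 2))"
  have summ: "summable (\<lambda>k. inverse (real (Suc k) ^ 2))"
    using inverse_power_summable[of 2, where 'a = real] by (subst summable_Suc_iff) auto
  \<comment> \<open>From |t + k| >= max 2 k follows |1/(t + k)| <= 2/(k + 1); the factor 4 is the
    square of this 2.\<close>
  define B where "B = 2 * (norm x + (norm x)\<^sup>2) * (4 * S)"
  \<comment> \<open>The first factor accounts for the sum of the second-order errors, the second for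
    replacing |exp(x Ln t)| by |t|^(Re x).\<close>
  define C where "C = exp B * exp (pi * \<bar>Im x\<bar>)"
  have main: "norm (rGamma (x + t)) * norm (exp (x * Ln t)) \<le> exp B * norm (rGamma t) \<and>
      norm (rGamma t) \<le> exp B * (norm (rGamma (x + t)) * norm (exp (x * Ln t)))"
    if t: "Re t \<ge> 0" "norm t \<ge> K" for t
  proof -
    define e where "e = (\<lambda>k. x * Ln (1 + 1 / (t + of_nat k)) - Ln (1 + x * (1 / (t + of_nat k))))"
    have t': "norm t \<ge> 2" "norm t \<ge> 2 * norm x" using t by (auto simp: K_def)
    have e: "norm (e k) \<le> 2 * (norm x + (norm x)\<^sup>2) * (4 * inverse (real (Suc k) ^ 2))" for k
    proof -
      have n: "norm (t + of_nat k) \<ge> 2" "norm (t + of_nat k) \<ge> 2 * norm x" "norm (t + of_nat k) \<ge> real k"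
        using norm_add_of_nat_ge[OF t(1), of k] t' by linarith+
      have "norm (e k) \<le> 2 * (norm x + (norm x)\<^sup>2) * (norm (1 / (t + of_nat k)))\<^sup>2"
        unfolding e_def using n 
        by (intro norm_Ln_binomial_quotient_le) (auto simp: norm_mult norm_divide divide_le_eq)
      also have "norm (1 / (t + of_nat k)) \<le> 2 / real (Suc k)"
      proof -
        have "0 < norm (t + of_nat k)" using n by linarith
        thus ?thesis using n by (simp add: norm_divide field_simps)
      qed
      hence "(norm (1 / (t + of_nat k)))\<^sup>2 \<le> (2 / real (Suc k))\<^sup>2"
        by (intro power_mono) auto
      also have "\<dots> = 4 * inverse (real (Suc k) ^ 2)"
        by (simp add: power_divide field_simps)
      finally show ?thesis by (simp add: mult_left_mono)
    qed
    have sume: "norm (\<Sum>k\<le>n. e k) \<le> B" for n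
    proof -
      have "norm (\<Sum>k\<le>n. e k) \<le> (\<Sum>k\<le>n. 2 * (norm x + (norm x)\<^sup>2) * (4 * inverse (real (Suc k) ^ 2)))"
        by (intro sum_norm_le e)
      also have "\<dots> = 2 * (norm x + (norm x)\<^sup>2) * (4 * (\<Sum>k\<le>n. inverse (real (Suc k) ^ 2)))"
        by (simp add: sum_distrib_left)
      also have "\<dots> \<le> B"
        unfolding B_def S_def using summ by (intro mult_left_mono sum_le_suminf) auto
      finally show ?thesis .
    qed
    \<comment> \<open>For fixed t this part of the exponent tends to 0, so it needs no bound uniform
      in t.\<close>
    define d where "d = (\<lambda>n. x * (Ln (t + of_nat (Suc n)) - of_real (ln (real n))))"
    have d_lim: "d \<longlonglongrightarrow> 0"
    proof -
      have "(\<lambda>n. Ln (t + of_nat (Suc n)) - of_real (ln (real n))) \<longlonglongrightarrow> 0"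
      proof (rule Lim_transform_eventually)
        show "(\<lambda>n. Ln (1 + (t + 1) / of_nat n)) \<longlonglongrightarrow> 0"
        proof -
          have "(\<lambda>n. Ln (1 + (t + 1) / of_nat n)) \<longlonglongrightarrow> Ln (1 + 0)"
            by (intro tendsto_Ln tendsto_add tendsto_const lim_const_over_n) auto
          thus ?thesis by simp
        qed
        show "\<forall>\<^sub>F n in sequentially. Ln (1 + (t + 1) / of_nat n) = Ln (t + of_nat (Suc n)) - of_real (ln (real n))"
          using eventually_gt_at_top[of 0]
        proof eventually_elim
          case (elim n)
          have "Re (1 + (t + 1) / of_nat n) > 0"
            using t elim by (simp add: Re_divide_of_nat add_pos_nonneg)
          hence "1 + (t + 1) / of_nat n \<noteq> 0" by (metis less_irrefl zero_complex.simps(1))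
          moreover have "t + of_nat (Suc n) = of_real (real n) * (1 + (t + 1) / of_nat n)"
            using elim by (simp add: field_simps)
          ultimately show ?case
            using Ln_times_of_real[of "real n" "1 + (t + 1) / of_nat n"] elim by simp
        qed
      qed
      from tendsto_mult_right_zero[OF this, of x] show ?thesis 
        unfolding d_def .
    qed
    have lim1: "(\<lambda>n. rGamma_series t n * exp (d n)) \<longlonglongrightarrow> rGamma t * exp 0"
      by (intro tendsto_intros d_lim rGamma_series_LIMSEQ)
    have lim2: "(\<lambda>n. rGamma_series (x + t) n * exp (x * Ln t)) \<longlonglongrightarrow> rGamma (x + t) * exp (x * Ln t)"
      by (intro tendsto_intros rGamma_series_LIMSEQ)
    have eq: "rGamma_series (x + t) n * exp (x * Ln t) = rGamma_series t n * exp (d n) * exp (- (\<Sum>k\<le>n. e k))" for n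
      using rGamma_series_quotient[of t x n] t t' 
      by (simp add: e_def d_def exp_diff exp_minus divide_inverse)
    have expb: "norm (exp w) \<le> exp B" if "norm w \<le> B" for w :: complex
      using that by (meson dual_order.trans norm_exp exp_le_cancel_iff)
    have le1: "norm (rGamma_series (x + t) n * exp (x * Ln t)) \<le> exp B * norm (rGamma_series t n * exp (d n))" for n
      unfolding eq using expb[of "- (\<Sum>k\<le>n. e k)"] sume[of n]
      by (simp add: norm_mult mult.commute mult_right_mono del: norm_exp_eq_Re)
    have eq': "rGamma_series t n * exp (d n) = rGamma_series (x + t) n * exp (x * Ln t) * exp (\<Sum>k\<le>n. e k)" for n
      unfolding eq by (simp add: exp_minus)
    have le2: "norm (rGamma_series t n * exp (d n)) \<le> exp B * norm (rGamma_series (x + t) n * exp (x * Ln t))" for n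
      unfolding eq' using expb[of "(\<Sum>k\<le>n. e k)"] sume[of n]
      by (simp add: norm_mult mult.commute mult_right_mono del: norm_exp_eq_Re)
    have "norm (rGamma (x + t) * exp (x * Ln t)) \<le> exp B * norm (rGamma t * exp 0)"
      by (rule tendsto_le[OF _ tendsto_mult[OF tendsto_const tendsto_norm[OF lim1]] tendsto_norm[OF lim2]])
         (use le1 in auto)
    moreover have "norm (rGamma t * exp 0) \<le> exp B * norm (rGamma (x + t) * exp (x * Ln t))"
      by (rule tendsto_le[OF _ tendsto_mult[OF tendsto_const tendsto_norm[OF lim2]] tendsto_norm[OF lim1]])
         (use le2 in auto)
    ultimately show ?thesis by (simp add: norm_mult)
  qed
  have pw: "norm (exp (x * Ln t)) \<le> exp (pi * \<bar>Im x\<bar>) * norm t powr Re x \<and>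
      norm t powr Re x \<le> exp (pi * \<bar>Im x\<bar>) * norm (exp (x * Ln t))" if "t \<noteq> 0" for t
  proof -
    \<comment> \<open>The modulus of t^x differs from |t|^(Re x) by the factor exp(- Im x Arg t),
      and |Arg t| <= pi.\<close>
    have n: "norm (exp (x * Ln t)) = norm t powr Re x * exp (- (Im x * Im (Ln t)))"
      using that by (simp add: powr_def exp_diff exp_minus divide_inverse algebra_simps)
    have "\<bar>Im x * Im (Ln t)\<bar> \<le> \<bar>Im x\<bar> * pi"
      unfolding abs_mult using mpi_less_Im_Ln[OF that] Im_Ln_le_pi[OF that]
      by (intro mult_left_mono) auto
    hence b: "- (Im x * Im (Ln t)) \<le> pi * \<bar>Im x\<bar>" "Im x * Im (Ln t) \<le> pi * \<bar>Im x\<bar>"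
      by (auto simp: abs_le_iff mult.commute)
    have "norm t powr Re x * 1 = norm t powr Re x * (exp (Im x * Im (Ln t)) * exp (- (Im x * Im (Ln t))))"
      by (simp add: exp_minus)
    also have "\<dots> \<le> norm t powr Re x * (exp (pi * \<bar>Im x\<bar>) * exp (- (Im x * Im (Ln t))))"
      using b by (intro mult_left_mono mult_right_mono) auto
    finally have "norm t powr Re x \<le> exp (pi * \<bar>Im x\<bar>) * norm (exp (x * Ln t))"
      unfolding n by (simp add: mult_ac)
    moreover have "norm (exp (x * Ln t)) \<le> exp (pi * \<bar>Im x\<bar>) * norm t powr Re x"
      unfolding n using b(1) by (subst mult.commute) (intro mult_right_mono, auto)
    ultimately show ?thesis by simp
  qed
  show ?thesis
  proof (rule that)
    show "C > 0" "K \<ge> 2" by (auto simp: C_def K_def)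
  next
    fix t assume t: "Re t \<ge> 0" "norm t \<ge> K"
    hence "t \<noteq> 0" by (auto simp: K_def)
    note m = main[OF t] and p = pw[OF this]
    have "norm (rGamma (x + t)) * norm t powr Re x
        \<le> norm (rGamma (x + t)) * (exp (pi * \<bar>Im x\<bar>) * norm (exp (x * Ln t)))"
      using p by (intro mult_left_mono) auto
    also have "\<dots> = exp (pi * \<bar>Im x\<bar>) * (norm (rGamma (x + t)) * norm (exp (x * Ln t)))"
      by (simp add: mult_ac)
    also have "\<dots> \<le> exp (pi * \<bar>Im x\<bar>) * (exp B * norm (rGamma t))"
      using m by (intro mult_left_mono) auto
    finally have 1: "norm (rGamma (x + t)) * norm t powr Re x \<le> C * norm (rGamma t)"
      by (simp add: C_def mult_ac)
    have "norm (rGamma t) \<le> exp B * (norm (rGamma (x + t)) * norm (exp (x * Ln t)))"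
      using m by simp
    also have "\<dots> \<le> exp B * (norm (rGamma (x + t)) * (exp (pi * \<bar>Im x\<bar>) * norm t powr Re x))"
      using p by (intro mult_left_mono) auto
    finally have 2: "norm (rGamma t) \<le> C * (norm (rGamma (x + t)) * norm t powr Re x)"
      by (simp add: C_def mult_ac)
    show "norm (rGamma (x + t)) * norm t powr Re x \<le> C * norm (rGamma t) \<and>
       norm (rGamma t) \<le> C * (norm (rGamma (x + t)) * norm t powr Re x)" using 1 2 by simp
  qed
qed

section \<open>Sines on large rectangles\<close>

lemma norm_sin_le_exp: "norm (sin (w :: complex)) \<le> exp \<bar>Im w\<bar>"
proof -
  have "norm (exp (\<i> * w) - exp (- (\<i> * w))) \<le> norm (exp (\<i> * w)) + norm (exp (- (\<i> * w)))"
    by (rule norm_triangle_ineq4)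
  also have "\<dots> \<le> exp \<bar>Im w\<bar> + exp \<bar>Im w\<bar>"
    by (intro add_mono) auto
  finally show ?thesis
    by (simp add: sin_exp_eq norm_divide norm_mult)
qed

text \<open>In hyperbolic form the right-hand side is sinh(Im w)^2 + sin(Re w)^2; the absolute
  values only make the larger exponential explicit.\<close>

lemma norm_sin_sq: "(norm (sin (w :: complex)))\<^sup>2 = (exp \<bar>Im w\<bar> - exp (- \<bar>Im w\<bar>))\<^sup>2 / 4 + (sin (Re w))\<^sup>2"
proof -
  have "(exp \<bar>Im w\<bar> - exp (- \<bar>Im w\<bar>))\<^sup>2 = exp (2 * Im w) + inverse (exp (2 * Im w)) - 2"
    by (cases "Im w \<ge> 0") (auto simp: power2_diff exp_minus field_simps power2_eq_square simp flip: exp_add)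
  moreover have "(sin (Re w))\<^sup>2 = (1 - cos (2 * Re w)) / 2"
    by (simp add: cos_double_sin)
  ultimately show ?thesis
    unfolding norm_sin_squared by (simp only: diff_divide_distrib add_divide_distrib)
qed

text \<open>Writing sinh and cosh at Im w and sin at Re w, sin^2 cosh^2 = sin^2 sinh^2 + sin^2 <=
  sinh^2 + sin^2, and cosh is at least half the exponential. This serves the vertical sides, where
  sin(Re w) is constant up to sign.\<close>

lemma norm_sin_ge_sin_Re: "norm (sin (w :: complex)) \<ge> \<bar>sin (Re w)\<bar> * (exp \<bar>Im w\<bar> / 2)"
proof (rule power2_le_imp_le)
  define E where "E = exp \<bar>Im w\<bar>"
  have E: "E \<ge> 1" by (simp add: E_def)
  have "(\<bar>sin (Re w)\<bar> * (E / 2))\<^sup>2 = (sin (Re w))\<^sup>2 * (E\<^sup>2 / 4)"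
    by (simp add: power_mult_distrib power_divide)
  also have "\<dots> \<le> (sin (Re w))\<^sup>2 * ((E - 1/E)\<^sup>2 / 4 + 1)"
  proof (rule mult_left_mono)
    have "(E - 1/E)\<^sup>2 = E\<^sup>2 - 2 + (1/E)\<^sup>2" using E by (simp add: power2_diff)
    moreover have "(1/E)\<^sup>2 \<ge> 0" by simp
    ultimately show "E\<^sup>2 / 4 \<le> (E - 1/E)\<^sup>2 / 4 + 1" by linarith
  qed simp
  also have "\<dots> \<le> (E - 1/E)\<^sup>2 / 4 + (sin (Re w))\<^sup>2"
  proof -
    have "(sin (Re w))\<^sup>2 * X \<le> 1 * X" if "X \<ge> 0" for X
      using that by (intro mult_right_mono) (auto simp: abs_square_le_1)
    from this[of "(E - 1/E)\<^sup>2 / 4"] show ?thesis by (simp only: distrib_left) simp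
  qed
  also have "\<dots> = (norm (sin w))\<^sup>2"
    unfolding norm_sin_sq E_def exp_minus by (simp add: inverse_eq_divide)
  finally show "(\<bar>sin (Re w)\<bar> * (exp \<bar>Im w\<bar> / 2))\<^sup>2 \<le> (norm (sin w))\<^sup>2" unfolding E_def .
qed auto

text \<open>Here sinh alone suffices: the larger exponential is at least 2, so the subtracted one is
  at most half of it. This serves the horizontal sides, on which sin(Re w) may vanish.\<close>

lemma norm_sin_ge_exp: 
  assumes "\<bar>Im w\<bar> \<ge> 1"
  shows "norm (sin (w :: complex)) \<ge> exp \<bar>Im w\<bar> / 4"
proof (rule power2_le_imp_le)
  define E F where "E = exp \<bar>Im w\<bar>" and "F = exp (- \<bar>Im w\<bar>)"
  have "E \<ge> 2"
    using exp_ge_add_one_self[of "\<bar>Im w\<bar>"] assms unfolding E_def by linarith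
  moreover have "F \<le> 1" by (simp add: F_def)
  ultimately have "E / 2 \<le> E - F" "E / 2 \<ge> 0" by linarith+
  hence "(E / 2)\<^sup>2 \<le> (E - F)\<^sup>2" by (rule power_mono)
  moreover have "(E / 4)\<^sup>2 = (E / 2)\<^sup>2 / 4" by (simp add: power_divide)
  ultimately have "(E / 4)\<^sup>2 \<le> (E - F)\<^sup>2 / 4 + (sin (Re w))\<^sup>2"
    using zero_le_power2[of "sin (Re w)"] by linarith
  thus "(exp \<bar>Im w\<bar> / 4)\<^sup>2 \<le> (norm (sin w))\<^sup>2" 
    unfolding norm_sin_sq E_def F_def .
qed auto

text \<open>The exponential is the maximal growth of each sine, so in this region the reciprocal
  sines decay as fast as possible. S is meant to contain the shifts of the sines that reflection
  puts into denominators.\<close>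

definition sine_region :: "complex set \<Rightarrow> real \<Rightarrow> complex set" where
  "sine_region S \<kappa> = {t. \<forall>c\<in>S. norm (sin (of_real pi * (c + t))) \<ge> \<kappa> * exp (pi * \<bar>Im t\<bar>)}"

text \<open>The forbidden values of \<open>\<theta>\<close> are countably many, while the open unit
  interval is uncountable.\<close>

lemma exists_avoiding_Ints:
  assumes "finite (S :: real set)"
  obtains \<theta> where "0 < \<theta>" "\<theta> < 1" "\<And>x. x \<in> S \<Longrightarrow> x + \<theta> \<notin> \<int>"
proof -
  have "countable (\<Union>x\<in>S. (\<lambda>n. n - x) ` (\<int> :: real set))"
    using assms by (intro countable_UN countable_image) (auto simp: countable_finite countable_int)
  hence "uncountable ({0<..<1} - (\<Union>x\<in>S. (\<lambda>n. n - x) ` (\<int> :: real set)))"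
    by (intro uncountable_minus_countable) (auto simp: uncountable_open_interval)
  then obtain \<theta> where \<theta>: "\<theta> \<in> {0<..<1} - (\<Union>x\<in>S. (\<lambda>n. n - x) ` (\<int> :: real set))"
    by (metis countable_empty ex_in_conv)
  show ?thesis
  proof (rule that[of \<theta>])
    fix x assume "x \<in> S"
    show "x + \<theta> \<notin> \<int>"
    proof
      assume "x + \<theta> \<in> \<int>"
      hence "\<theta> \<in> (\<lambda>n. n - x) ` \<int>" by (intro image_eqI[of _ _ "x + \<theta>"]) auto
      thus False using \<theta> \<open>x \<in> S\<close> by auto
    qed
  qed (use \<theta> in auto)
qed

text \<open>Centring at \<open>\<theta>\<close> instead of 0 makes the real parts of all vertical
  sides congruent to \<open>\<theta>\<close> modulo 1, so that one choice of \<open>\<theta>\<close>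
  keeps them away from the zeros of the sines for every N.\<close>

definition rect :: "real \<Rightarrow> nat \<Rightarrow> real \<Rightarrow> complex" where
  "rect \<theta> N = rectpath (Complex (\<theta> - real N) (- real N)) (Complex (\<theta> + real N) (real N))"

lemma path_image_rect:
  "path_image (rect \<theta> N) \<subseteq> {t. (Re t = \<theta> - real N \<or> Re t = \<theta> + real N \<or> \<bar>Im t\<bar> = real N)}"
  unfolding rect_def by (subst path_image_rectpath) (auto simp: path_image_rectpath)

text \<open>On vertical sides Re (c + t) differs from Re c + \<open>\<theta>\<close> by an integer,
  which changes the real sine only in sign. On horizontal sides |Im w| >= 1 as soon as N >= |Im c| +
  1. Finiteness of S makes constant and threshold uniform in c.\<close>

lemma rect_sine_region:
  assumes "finite S" "\<And>c. c \<in> S \<Longrightarrow> Re c + \<theta> \<notin> \<int>"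
  obtains \<kappa> where "\<kappa> > 0" "eventually (\<lambda>N. path_image (rect \<theta> N) \<subseteq> sine_region S \<kappa>) sequentially"
proof -
  \<comment> \<open>The minimum covers the two kinds of sides; the last factor pays for replacing Im
    (c + t) by Im t in the exponential.\<close>
  define k where "k = (\<lambda>c. min (\<bar>sin (pi * (Re c + \<theta>))\<bar> / 2) (1 / 4) * exp (- pi * \<bar>Im c\<bar>))"
  have kpos: "k c > 0" if "c \<in> S" for c
  proof -
    have "sin (pi * (Re c + \<theta>)) \<noteq> 0"
      using assms(2)[OF that] by (auto simp: sin_zero_iff_int2 elim!: Ints_cases)
    thus ?thesis unfolding k_def by auto
  qed
  \<comment> \<open>Inserting 1 keeps the minimum meaningful when S is empty.\<close>
  define \<kappa> where "\<kappa> = Min (insert 1 (k ` S))"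
  have \<kappa>: "\<kappa> > 0" "\<And>c. c \<in> S \<Longrightarrow> \<kappa> \<le> k c"
    using assms(1) kpos by (auto simp: \<kappa>_def)
  have "eventually (\<lambda>N. \<forall>c\<in>S. real N \<ge> \<bar>Im c\<bar> + 1) sequentially"
    using assms(1) 
    by (intro eventually_ball_finite ballI filterlim_real_sequentially[unfolded filterlim_at_top, rule_format])
  hence "eventually (\<lambda>N. path_image (rect \<theta> N) \<subseteq> sine_region S \<kappa>) sequentially"
  proof eventually_elim
    case (elim N)
    show ?case
    proof
      fix t assume "t \<in> path_image (rect \<theta> N)"
      hence t: "Re t = \<theta> - real N \<or> Re t = \<theta> + real N \<or> \<bar>Im t\<bar> = real N"
        using path_image_rect by blast
      show "t \<in> sine_region S \<kappa>"
        unfolding sine_region_def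
      proof (clarify)
        fix c assume c: "c \<in> S"
        define w where "w = of_real pi * (c + t)"
        have Im: "\<bar>Im w\<bar> = pi * \<bar>Im c + Im t\<bar>" by (simp add: w_def abs_mult)
        have "norm (sin w) \<ge> min (\<bar>sin (pi * (Re c + \<theta>))\<bar> / 2) (1/4) * exp \<bar>Im w\<bar>"
        proof (cases "\<bar>Im t\<bar> = real N")
          case True
          hence "\<bar>Im c + Im t\<bar> \<ge> 1" using elim c by fastforce
          hence "pi * 1 \<le> \<bar>Im w\<bar>" unfolding Im by (intro mult_left_mono) auto
          hence "1 \<le> \<bar>Im w\<bar>" using pi_gt3 by linarith
          from norm_sin_ge_exp[OF this] have "1 / 4 * exp \<bar>Im w\<bar> \<le> norm (sin w)" by simp
          moreover have "min (\<bar>sin (pi * (Re c + \<theta>))\<bar> / 2) (1/4) * exp \<bar>Im w\<bar> \<le> 1 / 4 * exp \<bar>Im w\<bar>"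
            by (intro mult_right_mono) auto
          ultimately show ?thesis by linarith
        next
          case False
          have "\<bar>sin (Re w)\<bar> = \<bar>sin (pi * (Re c + \<theta>))\<bar>"
            using t False sin_add[of "pi * (Re c + \<theta>)" "pi * real N"] sin_diff[of "pi * (Re c + \<theta>)" "pi * real N"]
            by (auto simp: w_def algebra_simps abs_mult power_abs)
          with norm_sin_ge_sin_Re[of w] 
          have "\<bar>sin (pi * (Re c + \<theta>))\<bar> / 2 * exp \<bar>Im w\<bar> \<le> norm (sin w)" by simp
          moreover have "min (\<bar>sin (pi * (Re c + \<theta>))\<bar> / 2) (1/4) * exp \<bar>Im w\<bar> \<le> \<bar>sin (pi * (Re c + \<theta>))\<bar> / 2 * exp \<bar>Im w\<bar>"
            by (intro mult_right_mono) auto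
          ultimately show ?thesis by linarith
        qed
        moreover have "exp (- pi * \<bar>Im c\<bar>) * exp (pi * \<bar>Im t\<bar>) \<le> exp \<bar>Im w\<bar>"
        proof -
          have "\<bar>Im t\<bar> - \<bar>Im c\<bar> \<le> \<bar>Im c + Im t\<bar>" by linarith
          hence "pi * (\<bar>Im t\<bar> - \<bar>Im c\<bar>) \<le> \<bar>Im w\<bar>" unfolding Im by (intro mult_left_mono) auto
          thus ?thesis unfolding exp_add[symmetric] exp_le_cancel_iff by (simp add: algebra_simps)
        qed
        hence "min (\<bar>sin (pi * (Re c + \<theta>))\<bar> / 2) (1/4) * (exp (- pi * \<bar>Im c\<bar>) * exp (pi * \<bar>Im t\<bar>)) \<le>
            min (\<bar>sin (pi * (Re c + \<theta>))\<bar> / 2) (1/4) * exp \<bar>Im w\<bar>"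
          by (intro mult_left_mono) auto
        ultimately have "k c * exp (pi * \<bar>Im t\<bar>) \<le> norm (sin w)"
          by (simp add: k_def mult_ac)
        moreover have "\<kappa> * exp (pi * \<bar>Im t\<bar>) \<le> k c * exp (pi * \<bar>Im t\<bar>)"
          using \<kappa>(2)[OF c] by (intro mult_right_mono) auto
        ultimately show "\<kappa> * exp (pi * \<bar>Im t\<bar>) \<le> norm (sin (of_real pi * (c + t)))"
          unfolding w_def by linarith
      qed
    qed
  qed
  with \<kappa>(1) show ?thesis by (rule that)
qed

section \<open>Decay of the integrand\<close>

text \<open>Multiplying weights adds their three exponents, so sizes of products of Gamma factors
  become linear arithmetic. The exponent of \<open>Gamma t\<close> is carried along because a single
  factor is known only relative to \<open>Gamma t\<close>; it cancels in the full integrand.\<close>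

definition growth_weight :: "real \<Rightarrow> real \<Rightarrow> real \<Rightarrow> complex \<Rightarrow> real" where
  "growth_weight \<alpha> m e t = norm t powr \<alpha> * norm (Gamma t) powr m * exp (pi * \<bar>Im t\<bar>) powr e"

abbreviation at_infinity_within :: "complex set \<Rightarrow> complex filter" where
  "at_infinity_within R \<equiv> inf at_infinity (principal R)"

lemma growth_weight_mult:
  "growth_weight \<alpha> m e t * growth_weight \<alpha>' m' e' t = growth_weight (\<alpha> + \<alpha>') (m + m') (e + e') t"
  by (simp add: growth_weight_def powr_add)

lemma bigo_growth_weight_mult:
  fixes f g :: "complex \<Rightarrow> complex"
  assumes "(\<lambda>t. norm (f t)) \<in> O[F](growth_weight \<alpha> m e)"
    and "(\<lambda>t. norm (g t)) \<in> O[F](growth_weight \<alpha>' m' e')"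
  shows "(\<lambda>t. norm (f t * g t)) \<in> O[F](growth_weight (\<alpha> + \<alpha>') (m + m') (e + e'))"
  using landau_o.big.mult[OF assms] by (simp add: growth_weight_mult norm_mult)

lemma right_half_plane_not_nonpos_Int:
  assumes "Re t \<ge> 0" "t \<noteq> 0"
  shows "t \<notin> \<int>\<^sub>\<le>\<^sub>0"
  using assms by (auto elim!: nonpos_Ints_cases simp: complex_eq_iff)

lemma right_half_plane_subset:
  assumes "R \<subseteq> {t. Re t \<ge> 0}" "t \<in> R" "norm t \<ge> 1"
  shows "t \<noteq> 0" "t \<notin> \<int>\<^sub>\<le>\<^sub>0"
proof -
  show "t \<noteq> 0" using assms by auto
  thus "t \<notin> \<int>\<^sub>\<le>\<^sub>0" using assms by (intro right_half_plane_not_nonpos_Int) auto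
qed

lemma bigo_growth_weight_prod_list:
  fixes f :: "'a \<Rightarrow> complex \<Rightarrow> complex"
  assumes "R \<subseteq> {t. Re t \<ge> 0}"
    and "\<And>x. x \<in> set xs \<Longrightarrow> (\<lambda>t. norm (f x t)) \<in> O[at_infinity_within R](growth_weight (\<alpha> x) m e)"
  shows "(\<lambda>t. norm (\<Prod>x\<leftarrow>xs. f x t)) \<in> O[at_infinity_within R](growth_weight (\<Sum>x\<leftarrow>xs. \<alpha> x) (m * length xs) (e * length xs))"
  using assms(2)
proof (induction xs)
  case Nil
  \<comment> \<open>Since 0 powr 0 = 0, the weight with zero exponents is 1 only where t and
    \<open>Gamma t\<close> are nonzero; in the right half-plane this holds eventually.\<close>
  have "eventually (\<lambda>t. 1 = growth_weight 0 0 0 t) (at_infinity_within R)"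
    unfolding eventually_inf_principal eventually_at_infinity
  proof (intro exI[of _ 1] allI impI)
    fix t :: complex assume t: "1 \<le> norm t" "t \<in> R"
    hence "t \<noteq> 0" "t \<notin> \<int>\<^sub>\<le>\<^sub>0" using right_half_plane_subset[OF assms(1)] by auto
    thus "1 = growth_weight 0 0 0 t" by (simp add: growth_weight_def Gamma_eq_zero_iff)
  qed
  hence "(\<lambda>_. 1) \<in> O[at_infinity_within R](growth_weight 0 0 0)"
    by (intro bigthetaD1 bigthetaI_cong)
  thus ?case by simp
next
  case (Cons x xs)
  have "(\<lambda>t. norm (f x t * (\<Prod>y\<leftarrow>xs. f y t))) \<in> O[at_infinity_within R](growth_weight (\<alpha> x + (\<Sum>x\<leftarrow>xs. \<alpha> x)) (m + m * length xs) (e + e * length xs))"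
    by (intro bigo_growth_weight_mult Cons) (use Cons.prems in auto)
  thus ?case by (simp add: algebra_simps)
qed

lemma norm_rGamma_eq_powr: "norm (rGamma t) = norm (Gamma t) powr (-1)" for t :: complex
  by (simp add: powr_minus Gamma_def norm_inverse)

lemma rGamma_shift_bigo:
  assumes "R \<subseteq> {t. Re t \<ge> 0}"
  shows "(\<lambda>t. norm (rGamma (x + t))) \<in> O[at_infinity_within R](growth_weight (- Re x) (-1) 0)"
    and "(\<lambda>t. norm (Gamma (x + t))) \<in> O[at_infinity_within R](growth_weight (Re x) 1 0)"
    and "eventually (\<lambda>t. rGamma (x + t) \<noteq> 0) (at_infinity_within R)"
proof -
  obtain C K where CK: "C > 0" "K \<ge> 2"
    "\<And>t. Re t \<ge> 0 \<Longrightarrow> norm t \<ge> K \<Longrightarrow>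
       norm (rGamma (x + t)) * norm t powr Re x \<le> C * norm (rGamma t) \<and>
       norm (rGamma t) \<le> C * (norm (rGamma (x + t)) * norm t powr Re x)"
    using Gamma_shift_asymp[of x] by blast
  have *: "norm (rGamma (x + t)) \<le> C * growth_weight (- Re x) (-1) 0 t \<and>
      norm (Gamma (x + t)) \<le> C * growth_weight (Re x) 1 0 t \<and> rGamma (x + t) \<noteq> 0"
    if t: "t \<in> R" "norm t \<ge> K" for t
  proof -
    have nz: "t \<noteq> 0" "t \<notin> \<int>\<^sub>\<le>\<^sub>0" using right_half_plane_subset[OF assms, of t] t CK(2) by auto
    hence r: "norm (rGamma t) > 0" by (simp add: rGamma_eq_zero_iff)
    have b: "norm (rGamma (x + t)) * norm t powr Re x \<le> C * norm (rGamma t)"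
       "norm (rGamma t) \<le> C * (norm (rGamma (x + t)) * norm t powr Re x)"
      using CK(3)[of t] t assms by auto
    from b(2) r have nz': "rGamma (x + t) \<noteq> 0" by auto
    have g: "growth_weight (- Re x) (-1) 0 t = norm (rGamma t) / norm t powr Re x"
        "growth_weight (Re x) 1 0 t = norm t powr Re x / norm (rGamma t)"
      using nz by (simp_all add: growth_weight_def norm_rGamma_eq_powr powr_minus field_simps)
    have p: "norm t powr Re x > 0" using nz by simp
    have "norm (rGamma (x + t)) \<le> C * growth_weight (- Re x) (-1) 0 t"
      unfolding g using b(1) p by (simp add: field_simps)
    moreover have "norm (Gamma (x + t)) \<le> C * growth_weight (Re x) 1 0 t"
      unfolding g Gamma_def norm_inverse using b(2) r nz' by (simp add: field_simps)
    ultimately show ?thesis using nz' by blast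
  qed
  have gw: "\<bar>growth_weight \<alpha> m e t\<bar> = growth_weight \<alpha> m e t" for \<alpha> m e t
    by (simp add: growth_weight_def abs_mult)
  show "(\<lambda>t. norm (rGamma (x + t))) \<in> O[at_infinity_within R](growth_weight (- Re x) (-1) 0)"
    by (rule bigoI[of _ C])
       (auto simp: eventually_inf_principal eventually_at_infinity gw intro!: exI[of _ K] dest!: *)
  show "(\<lambda>t. norm (Gamma (x + t))) \<in> O[at_infinity_within R](growth_weight (Re x) 1 0)"
    by (rule bigoI[of _ C])
       (auto simp: eventually_inf_principal eventually_at_infinity gw intro!: exI[of _ K] dest!: *)
  show "eventually (\<lambda>t. rGamma (x + t) \<noteq> 0) (at_infinity_within R)"
    using * by (auto simp: eventually_inf_principal eventually_at_infinity)
qed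

lemma growth_weight_exp: 
  assumes "R \<subseteq> {t. Re t \<ge> 0}" 
  shows "eventually (\<lambda>t. exp (pi * \<bar>Im t\<bar>) powr e = growth_weight 0 0 e t) (at_infinity_within R)"
  unfolding eventually_inf_principal eventually_at_infinity
proof (intro exI[of _ 1] allI impI)
  fix t :: complex assume t: "1 \<le> norm t" "t \<in> R"
  hence "t \<noteq> 0" "t \<notin> \<int>\<^sub>\<le>\<^sub>0" using right_half_plane_subset[OF assms(1)] by auto
  thus "exp (pi * \<bar>Im t\<bar>) powr e = growth_weight 0 0 e t" by (simp add: growth_weight_def Gamma_eq_zero_iff)
qed

text \<open>By reflection, rGamma(1 - x - t) = Gamma(x + t) sin(pi (x + t)) / pi. The sine stands in
  the numerator, where its exponential upper bound holds for all t.\<close>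

lemma rGamma_reflected_bigo:
  assumes "R \<subseteq> {t. Re t \<ge> 0}"
  shows "(\<lambda>t. norm (rGamma (1 - x - t))) \<in> O[at_infinity_within R](growth_weight (Re x) 1 1)"
proof -
  have "(\<lambda>t. norm (sin (of_real pi * (x + t)))) \<in> O[at_infinity_within R](\<lambda>t. exp (pi * \<bar>Im t\<bar>) powr 1)"
  proof (rule bigoI[of _ "exp (pi * \<bar>Im x\<bar>)"], rule always_eventually, rule allI)
    fix t
    have "norm (sin (of_real pi * (x + t))) \<le> exp \<bar>Im (of_real pi * (x + t))\<bar>"
      by (rule norm_sin_le_exp)
    also have "\<bar>Im (of_real pi * (x + t))\<bar> = pi * \<bar>Im x + Im t\<bar>" by (simp add: abs_mult)
    also have "\<dots> \<le> pi * (\<bar>Im x\<bar> + \<bar>Im t\<bar>)" by (intro mult_left_mono) auto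
    finally show "norm (norm (sin (of_real pi * (x + t)))) \<le> exp (pi * \<bar>Im x\<bar>) * norm (exp (pi * \<bar>Im t\<bar>) powr 1)"
      by (simp add: distrib_left exp_add)
  qed
  hence "(\<lambda>t. norm (sin (of_real pi * (x + t)))) \<in> O[at_infinity_within R](growth_weight 0 0 1)"
    by (subst (asm) landau_o.big.cong[OF growth_weight_exp[OF assms]])
  from bigo_growth_weight_mult[OF rGamma_shift_bigo(2)[OF assms, of x] this]
  have "(\<lambda>t. norm (Gamma (x + t) * sin (of_real pi * (x + t)))) \<in> O[at_infinity_within R](growth_weight (Re x) 1 1)"
    by simp
  hence "(\<lambda>t. inverse pi * norm (Gamma (x + t) * sin (of_real pi * (x + t)))) \<in> O[at_infinity_within R](growth_weight (Re x) 1 1)"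
    by simp
  moreover have "eventually (\<lambda>t. inverse pi * norm (Gamma (x + t) * sin (of_real pi * (x + t))) = norm (rGamma (1 - x - t)))
     (at_infinity_within R)"
    using rGamma_shift_bigo(3)[OF assms, of x]
  proof eventually_elim
    case (elim t)
    have "rGamma (1 - (x + t)) = inverse (of_real pi) * (Gamma (x + t) * sin (of_real pi * (x + t)))"
      using rGamma_reflection_complex[of "x + t"] elim by (simp add: Gamma_def field_simps)
    thus ?case by (simp add: norm_mult norm_inverse diff_diff_eq norm_divide)
  qed
  ultimately show ?thesis by (rule landau_o.big.in_cong[THEN iffD1, rotated])
qed

text \<open>By reflection, Gamma(1 - x - t) = pi rGamma(x + t) / sin(pi (x + t)). Now the sine
  stands in the denominator, hence the lower bound assumed on R.\<close>

lemma Gamma_reflected_bigo: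
  assumes "R \<subseteq> {t. Re t \<ge> 0}" "\<kappa> > 0"
    and sine: "\<And>t. t \<in> R \<Longrightarrow> norm (sin (of_real pi * (x + t))) \<ge> \<kappa> * exp (pi * \<bar>Im t\<bar>)"
  shows "(\<lambda>t. norm (Gamma (1 - x - t))) \<in> O[at_infinity_within R](growth_weight (- Re x) (-1) (-1))"
proof -
  have "(\<lambda>t. norm (inverse (sin (of_real pi * (x + t))))) \<in> O[at_infinity_within R](\<lambda>t. exp (pi * \<bar>Im t\<bar>) powr (-1))"
  proof (rule bigoI[of _ "inverse \<kappa>"])
    have "norm (inverse (sin (of_real pi * (x + t)))) \<le> inverse (\<kappa> * exp (pi * \<bar>Im t\<bar>))" if "t \<in> R" for t
      unfolding norm_inverse using sine[OF that] assms(2) by (intro le_imp_inverse_le) auto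
    thus "\<forall>\<^sub>F t in at_infinity_within R. norm (norm (inverse (sin (of_real pi * (x + t)))))
       \<le> inverse \<kappa> * norm (exp (pi * \<bar>Im t\<bar>) powr (-1))"
      unfolding eventually_inf_principal 
      by (intro always_eventually allI impI) (auto simp: powr_minus exp_minus)
  qed
  hence "(\<lambda>t. norm (inverse (sin (of_real pi * (x + t))))) \<in> O[at_infinity_within R](growth_weight 0 0 (-1))"
    by (subst (asm) landau_o.big.cong[OF growth_weight_exp[OF assms(1)]])
  from bigo_growth_weight_mult[OF rGamma_shift_bigo(1)[OF assms(1), of x] this]
  have "(\<lambda>t. norm (rGamma (x + t) * inverse (sin (of_real pi * (x + t))))) \<in> O[at_infinity_within R](growth_weight (- Re x) (-1) (-1))"
    by simp
  hence "(\<lambda>t. pi * norm (rGamma (x + t) * inverse (sin (of_real pi * (x + t))))) \<in> O[at_infinity_within R](growth_weight (- Re x) (-1) (-1))"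
    by simp
  moreover have "eventually (\<lambda>t. pi * norm (rGamma (x + t) * inverse (sin (of_real pi * (x + t)))) = norm (Gamma (1 - x - t)))
     (at_infinity_within R)"
    using rGamma_shift_bigo(3)[OF assms(1), of x] 
  proof eventually_elim
    case (elim t)
    have "Gamma (1 - (x + t)) = rGamma (x + t) * (Gamma (x + t) * Gamma (1 - (x + t)))"
      using elim by (simp add: Gamma_def)
    also have "\<dots> = of_real pi * (rGamma (x + t) * inverse (sin (of_real pi * (x + t))))"
      unfolding Gamma_reflection_complex by (simp add: divide_inverse)
    finally have "Gamma (1 - (x + t)) = of_real pi * (rGamma (x + t) * inverse (sin (of_real pi * (x + t))))" .
    thus ?case by (simp add: norm_mult norm_inverse diff_diff_eq)
  qed
  ultimately show ?thesis by (rule landau_o.big.in_cong[THEN iffD1, rotated])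
qed

text \<open>Denominators are written with the entire function \<open>rGamma\<close>, so that
  singularities can come only from the \<open>Gamma\<close> factors.\<close>

definition barnes_integrand ::
    "complex list \<Rightarrow> complex list \<Rightarrow> complex list \<Rightarrow> complex list \<Rightarrow> complex \<Rightarrow> complex" where
  "barnes_integrand a1 a2 b1 b2 t =
     (\<Prod>x\<leftarrow>a2. Gamma (x + t)) * (\<Prod>x\<leftarrow>b1. Gamma (1 - x - t)) *
     (\<Prod>x\<leftarrow>a1. rGamma (1 - x - t)) * (\<Prod>x\<leftarrow>b2. rGamma (x + t)) * (Gamma (-t) ^ 2 * Gamma (1 + t))"

text \<open>With \<open>Gamma\<close> exponent 0 and e <= 0 the last two factors of the weight are
  at most 1, which leaves a pure power of |t|.\<close>

lemma bigo_growth_weight_decay: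
  assumes "R \<subseteq> {t. Re t \<ge> 0}" "(\<lambda>t. norm (f t)) \<in> O[at_infinity_within R](growth_weight \<alpha> 0 e)" "e \<le> 0"
  obtains C K where "C > 0" "\<And>t. t \<in> R \<Longrightarrow> norm t \<ge> K \<Longrightarrow> norm (f t) \<le> C * norm t powr \<alpha>"
proof -
  obtain C where C: "C > 0" "eventually (\<lambda>t. norm (norm (f t)) \<le> C * norm (growth_weight \<alpha> 0 e t)) (at_infinity_within R)"
    using assms(2) by (elim landau_o.bigE)
  then obtain K where K: "\<And>t. t \<in> R \<Longrightarrow> norm t \<ge> K \<Longrightarrow> norm (f t) \<le> C * norm (growth_weight \<alpha> 0 e t)"
    by (auto simp: eventually_inf_principal eventually_at_infinity)
  have "growth_weight \<alpha> 0 e t \<le> norm t powr \<alpha> * 1 * 1" for t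
    unfolding growth_weight_def using assms(3)
    by (intro mult_mono) (auto simp: powr_def mult_nonpos_nonneg)
  hence "\<bar>growth_weight \<alpha> 0 e t\<bar> \<le> norm t powr \<alpha>" for t
    by (simp add: growth_weight_def abs_mult)
  hence "C * norm (growth_weight \<alpha> 0 e t) \<le> C * norm t powr \<alpha>" for t
    using C(1) by (intro mult_left_mono) auto
  from that[OF C(1) order_trans[OF K this]] show ?thesis by blast
qed

lemma Re_sum_list: "Re (sum_list xs) = (\<Sum>x\<leftarrow>xs. Re x)"
  by (induction xs) auto

text \<open>In the right half-plane the factors whose argument contains -t are reflected, in the
  left half-plane those whose argument contains t. Either way the exponents of Gamma cancel and the
  exponential gets the exponent \<open>length a1\<close> - \<open>length b1\<close> - 2, which is at
  most 0 by the second length assumption.\<close>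

lemma barnes_integrand_decay:
  assumes "\<kappa> > 0" and S: "{0, 1} \<union> set a2 \<union> set b1 \<subseteq> S"
    and len: "length a1 + length a2 = Suc (length b1 + length b2)" "length a1 \<le> length b1 + 2"
  obtains C K where "C > 0"
    "\<And>t. t \<in> sine_region S \<kappa> \<Longrightarrow> norm t \<ge> K \<Longrightarrow>
       norm (barnes_integrand a1 a2 b1 b2 t) \<le> 
       C * norm t powr (Re (sum_list (a1 @ a2) - sum_list (b1 @ b2)) - 1)"
proof -
  define \<alpha> where "\<alpha> = Re (sum_list (a1 @ a2) - sum_list (b1 @ b2)) - 1"
  define R1 where "R1 = {t \<in> sine_region S \<kappa>. Re t \<ge> 0}"
  \<comment> \<open>The left part of the region is mirrored, so that the right half-plane
    asymptotics apply to the integrand at -t.\<close>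
  define R2 where "R2 = uminus ` {t \<in> sine_region S \<kappa>. Re t \<le> 0}"
  have R: "R1 \<subseteq> {t. Re t \<ge> 0}" "R2 \<subseteq> {t. Re t \<ge> 0}" by (auto simp: R1_def R2_def)
  have s1: "norm (sin (of_real pi * (x + t))) \<ge> \<kappa> * exp (pi * \<bar>Im t\<bar>)" if "x \<in> S" "t \<in> R1" for x t
    using that by (auto simp: R1_def sine_region_def)
  \<comment> \<open>At -t the sine with shift x becomes the one with shift 1 - x, because sin(pi -
    u) = sin u.\<close>
  have s2: "norm (sin (of_real pi * (1 - x + t))) \<ge> \<kappa> * exp (pi * \<bar>Im t\<bar>)" if "x \<in> S" "t \<in> R2" for x t
  proof -
    have "sin (of_real pi * (1 - x + t)) = sin (of_real pi * (x + (- t)))"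
      using sin_diff[of "of_real pi" "of_real pi * (x + (- t))"]
      by (simp add: algebra_simps sin_of_real cos_of_real)
    thus ?thesis using that by (auto simp: R2_def sine_region_def)
  qed
  have 1: "(\<lambda>t. norm (barnes_integrand a1 a2 b1 b2 t)) \<in> O[at_infinity_within R1](growth_weight \<alpha> 0 (real (length a1) - real (length b1) - 2))"
  proof -
    note G = Gamma_reflected_bigo[OF R(1) assms(1)]
    have G0: "(\<lambda>t. norm (Gamma (- t))) \<in> O[at_infinity_within R1](growth_weight (-1) (-1) (-1))"
      using G[of 1] s1[of 1] S by simp
    \<comment> \<open>The exponents stay unevaluated here so that they match the factors one by one;
      \<open>e\<close> then evaluates the three sums, the exponent of Gamma to 0 by
      \<open>len\<close>.\<close>
    have m: "(\<lambda>t. norm (barnes_integrand a1 a2 b1 b2 t)) \<in> O[at_infinity_within R1](growth_weight ((\<Sum>x\<leftarrow>a2. Re x) + (\<Sum>x\<leftarrow>b1. - Re x) + (\<Sum>x\<leftarrow>a1. Re x) + (\<Sum>x\<leftarrow>b2. - Re x) + (-1 + -1 + Re 1))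
       (1 * real (length a2) + (-1) * real (length b1) + 1 * real (length a1) + (-1) * real (length b2) + (-1 + -1 + 1))
       (0 * real (length a2) + (-1) * real (length b1) + 1 * real (length a1) + 0 * real (length b2) + (-1 + -1 + 0)))"
      unfolding barnes_integrand_def power2_eq_square
      using S
      by (intro bigo_growth_weight_mult bigo_growth_weight_prod_list R rGamma_shift_bigo G s1
           rGamma_reflected_bigo G0) auto
    have e: "(\<Sum>x\<leftarrow>a2. Re x) + (\<Sum>x\<leftarrow>b1. - Re x) + (\<Sum>x\<leftarrow>a1. Re x) + (\<Sum>x\<leftarrow>b2. - Re x) + (-1 + -1 + Re 1) = \<alpha>"
       "1 * real (length a2) + (-1) * real (length b1) + 1 * real (length a1) + (-1) * real (length b2) + (-1 + -1 + 1) = 0"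
       "0 * real (length a2) + (-1) * real (length b1) + 1 * real (length a1) + 0 * real (length b2) + (-1 + -1 + 0) = (real (length a1) - real (length b1) - 2)"
      using len(1) by (simp_all add: \<alpha>_def Re_sum_list uminus_sum_list_map[unfolded o_def, symmetric])
    show ?thesis using m unfolding e .
  qed
  have 2: "(\<lambda>t. norm (barnes_integrand a1 a2 b1 b2 (- t))) \<in> O[at_infinity_within R2](growth_weight \<alpha> 0 (real (length a1) - real (length b1) - 2))"
  proof -
    have G: "(\<lambda>t. norm (Gamma (x + - t))) \<in> O[at_infinity_within R2](growth_weight (Re x - 1) (-1) (-1))"
      if "x \<in> S" for x
      using Gamma_reflected_bigo[OF R(2) assms(1) s2, OF that] by simp
    have rG: "(\<lambda>t. norm (rGamma (x + - t))) \<in> O[at_infinity_within R2](growth_weight (1 - Re x) 1 1)" for x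
      using rGamma_reflected_bigo[OF R(2), of "1 - x"] by simp
    have G': "(\<lambda>t. norm (Gamma (1 - x - - t))) \<in> O[at_infinity_within R2](growth_weight (1 - Re x) 1 0)" for x
      using rGamma_shift_bigo(2)[OF R(2), of "1 - x"] by simp
    have rG': "(\<lambda>t. norm (rGamma (1 - x - - t))) \<in> O[at_infinity_within R2](growth_weight (Re x - 1) (-1) 0)" for x
      using rGamma_shift_bigo(1)[OF R(2), of "1 - x"] by simp
    have G0: "(\<lambda>t. norm (Gamma (- (- t)))) \<in> O[at_infinity_within R2](growth_weight 0 1 0)"
      using rGamma_shift_bigo(2)[OF R(2), of 0] by simp
    have G1: "(\<lambda>t. norm (Gamma (1 + - t))) \<in> O[at_infinity_within R2](growth_weight (Re 1 - 1) (-1) (-1))"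
      using G[of 1] S by blast
    have m: "(\<lambda>t. norm (barnes_integrand a1 a2 b1 b2 (-t))) \<in> O[at_infinity_within R2](growth_weight ((\<Sum>x\<leftarrow>a2. Re x - 1) + (\<Sum>x\<leftarrow>b1. 1 - Re x) + (\<Sum>x\<leftarrow>a1. Re x - 1) + (\<Sum>x\<leftarrow>b2. 1 - Re x) + (0 + 0 + (Re 1 - 1)))
       ((-1) * real (length a2) + 1 * real (length b1) + (-1) * real (length a1) + 1 * real (length b2) + (1 + 1 + -1))
       ((-1) * real (length a2) + 0 * real (length b1) + 0 * real (length a1) + 1 * real (length b2) + (0 + 0 + (-1))))"
      unfolding barnes_integrand_def power2_eq_square
      using S
      by (intro bigo_growth_weight_mult bigo_growth_weight_prod_list R G rG G' rG' G0 G1) auto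
    have sl: "(\<Sum>x\<leftarrow>xs. Re x - 1) = Re (sum_list xs) - length xs" "(\<Sum>x\<leftarrow>xs. 1 - Re x) = length xs - Re (sum_list xs)" for xs
      by (induction xs) auto
    have len': "real (length a1) + real (length a2) = 1 + real (length b1) + real (length b2)"
      using len(1) by linarith
    have e: "(\<Sum>x\<leftarrow>a2. Re x - 1) + (\<Sum>x\<leftarrow>b1. 1 - Re x) + (\<Sum>x\<leftarrow>a1. Re x - 1) + (\<Sum>x\<leftarrow>b2. 1 - Re x) + (0 + 0 + (Re 1 - 1)) = \<alpha>"
       "(-1) * real (length a2) + 1 * real (length b1) + (-1) * real (length a1) + 1 * real (length b2) + (1 + 1 + -1) = 0"
       "(-1) * real (length a2) + 0 * real (length b1) + 0 * real (length a1) + 1 * real (length b2) + (0 + 0 + (-1)) = (real (length a1) - real (length b1) - 2)"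
      using len' by (simp_all add: \<alpha>_def sl)
    show ?thesis using m unfolding e .
  qed
  have len': "real (length a1) - real (length b1) - 2 \<le> 0" using len(2) by linarith
  obtain C1 K1 where 1: "C1 > 0" "\<And>t. t \<in> R1 \<Longrightarrow> norm t \<ge> K1 \<Longrightarrow>
       norm (barnes_integrand a1 a2 b1 b2 t) \<le> C1 * norm t powr \<alpha>"
    using bigo_growth_weight_decay[OF R(1) 1 len'] by blast
  obtain C2 K2 where 2: "C2 > 0" "\<And>t. t \<in> R2 \<Longrightarrow> norm t \<ge> K2 \<Longrightarrow>
       norm (barnes_integrand a1 a2 b1 b2 (- t)) \<le> C2 * norm t powr \<alpha>"
    using bigo_growth_weight_decay[OF R(2) 2 len'] by blast
  show ?thesis
  proof (rule that[of "max C1 C2" "max K1 K2"])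
    fix t assume t: "t \<in> sine_region S \<kappa>" "norm t \<ge> max K1 K2"
    have "norm (barnes_integrand a1 a2 b1 b2 t) \<le> C1 * norm t powr \<alpha> \<or> 
          norm (barnes_integrand a1 a2 b1 b2 t) \<le> C2 * norm t powr \<alpha>"
    proof (cases "Re t \<ge> 0")
      case False
      hence "- t \<in> R2" using t by (auto simp: R2_def)
      from 2(2)[OF this] t show ?thesis by auto
    qed (use t in \<open>auto intro!: disjI1 1 simp: R1_def\<close>)
    moreover have "C1 * norm t powr \<alpha> \<le> max C1 C2 * norm t powr \<alpha>" "C2 * norm t powr \<alpha> \<le> max C1 C2 * norm t powr \<alpha>"
      by (intro mult_right_mono; simp)+
    ultimately show "norm (barnes_integrand a1 a2 b1 b2 t) \<le> 
       max C1 C2 * norm t powr (Re (sum_list (a1 @ a2) - sum_list (b1 @ b2)) - 1)"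
      unfolding \<alpha>_def by linarith
  qed (use 1 in auto)
qed

section \<open>Convergence of the hypergeometric series\<close>

lemma pochhammer_Suc_rGamma_series:
  fixes x :: complex
  shows "pochhammer x (Suc n) = rGamma_series x n * (fact n * exp (x * of_real (ln (real n))))"
  by (simp add: rGamma_series_def)

text \<open>The Gauss product \<open>rGamma_series x\<close> converges and is therefore bounded. Its
  n-th term contains n + 1 factors, hence the index \<open>Suc n\<close>.\<close>

lemma pochhammer_Suc_bigo:
  fixes x :: complex
  shows "(\<lambda>n. norm (pochhammer x (Suc n))) \<in> O(\<lambda>n. fact n * real n powr Re x)"
proof -
  have "Bseq (rGamma_series x)"
    using rGamma_series_LIMSEQ[of x] by (intro convergent_imp_Bseq) (auto simp: convergent_def)
  then obtain B where B: "B > 0" "\<And>n. norm (rGamma_series x n) \<le> B" by (auto simp: Bseq_def)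
  show ?thesis
  proof (rule bigoI[of _ B])
    show "eventually (\<lambda>n. norm (norm (pochhammer x (Suc n))) \<le> B * norm (fact n * real n powr Re x)) sequentially"
      using eventually_gt_at_top[of 0]
    proof eventually_elim
      case (elim n)
      have "norm (pochhammer x (Suc n)) = norm (rGamma_series x n) * (fact n * real n powr Re x)"
        using elim unfolding pochhammer_Suc_rGamma_series norm_mult by (simp add: powr_def mult.commute)
      also have "\<dots> \<le> B * (fact n * real n powr Re x)" by (intro mult_right_mono B) auto
      finally show ?case by simp
    qed
  qed
qed

text \<open>Off the non-positive integers the Gauss product has the nonzero limit
  \<open>rGamma x\<close>, so its reciprocals are bounded as well.\<close>

lemma inverse_pochhammer_Suc_bigo:
  fixes x :: complex
  assumes "x \<notin> \<int>\<^sub>\<le>\<^sub>0"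
  shows "(\<lambda>n. norm (inverse (pochhammer x (Suc n)))) \<in> O(\<lambda>n. inverse (fact n * real n powr Re x))"
proof -
  have "(\<lambda>n. inverse (rGamma_series x n)) \<longlonglongrightarrow> inverse (rGamma x)"
    using assms by (intro tendsto_inverse rGamma_series_LIMSEQ) (auto simp: rGamma_eq_zero_iff)
  hence "Bseq (\<lambda>n. inverse (rGamma_series x n))"
    by (intro convergent_imp_Bseq) (auto simp: convergent_def)
  then obtain B where B: "B > 0" "\<And>n. norm (inverse (rGamma_series x n)) \<le> B" by (auto simp: Bseq_def)
  show ?thesis
  proof (rule bigoI[of _ B])
    show "eventually (\<lambda>n. norm (norm (inverse (pochhammer x (Suc n)))) \<le> B * norm (inverse (fact n * real n powr Re x))) sequentially"
      using eventually_gt_at_top[of 0]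
    proof eventually_elim
      case (elim n)
      have "norm (inverse (pochhammer x (Suc n))) = norm (inverse (rGamma_series x n)) * inverse (fact n * real n powr Re x)"
        using elim unfolding pochhammer_Suc_rGamma_series norm_mult norm_inverse inverse_mult_distrib
        by (simp add: powr_def mult.commute)
      also have "\<dots> \<le> B * inverse (fact n * real n powr Re x)" by (intro mult_right_mono B) auto
      finally show ?case by simp
    qed
  qed
qed

lemma pochL_Suc_bigo:
  "(\<lambda>n. norm (pochL xs (Suc n))) \<in> O(\<lambda>n. fact n ^ length xs * real n powr Re (sum_list xs))"
proof (induction xs)
  case Nil
  have "(\<lambda>n. 1 :: real) \<in> O(\<lambda>n. real n powr 0)"
    by (intro bigthetaD1 bigthetaI_cong eventually_mono[OF eventually_gt_at_top[of 0]]) auto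
  thus ?case by (simp add: pochL_def)
next
  case (Cons x xs)
  from landau_o.big.mult[OF pochhammer_Suc_bigo[of x] Cons.IH] show ?case
    by (simp add: pochL_def powr_add norm_mult mult_ac)
qed

lemma inverse_pochL_Suc_bigo:
  assumes "\<forall>x\<in>set xs. x \<notin> \<int>\<^sub>\<le>\<^sub>0"
  shows "(\<lambda>n. norm (inverse (pochL xs (Suc n)))) \<in> O(\<lambda>n. inverse (fact n ^ length xs * real n powr Re (sum_list xs)))"
  using assms
proof (induction xs)
  case Nil
  have "(\<lambda>n. 1 :: real) \<in> O(\<lambda>n. inverse (real n powr 0))"
    by (intro bigthetaD1 bigthetaI_cong eventually_mono[OF eventually_gt_at_top[of 0]]) auto
  thus ?case by (simp add: pochL_def)
next
  case (Cons x xs)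
  have "(\<lambda>n. norm (inverse (pochhammer x (Suc n))) * norm (inverse (pochL xs (Suc n)))) \<in>
     O(\<lambda>n. inverse (fact n * real n powr Re x) * inverse (fact n ^ length xs * real n powr Re (sum_list xs)))"
    by (intro landau_o.big.mult inverse_pochhammer_Suc_bigo Cons) (use Cons.prems in auto)
  thus ?case
    by (simp add: pochL_def powr_add norm_mult mult_ac)
qed

text \<open>The factorials cancel because there is one more upper than lower parameter. The terms
  are then O(n^(-1 - \<open>\<delta>\<close>)), where \<open>\<delta>\<close> > 0 is the real part
  of the lower minus the upper parameter sum, which gives absolute convergence even on the circle
  |z| = 1.\<close>

lemma summable_hypF:
  assumes "length as = Suc (length bs)" "Re (sum_list bs - sum_list as) > 0"
    and "\<forall>x\<in>set bs. x \<notin> \<int>\<^sub>\<le>\<^sub>0" "norm z \<le> 1"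
  shows "summable (\<lambda>k. pochL as k / pochL bs k * z ^ k / of_nat (fact k))"
proof -
  define \<delta> where "\<delta> = Re (sum_list bs - sum_list as)"
  have 1: "(\<lambda>n. norm (z ^ Suc n)) \<in> O(\<lambda>n. 1 :: real)"
    using assms(4) by (intro bigoI[of _ 1] always_eventually) (auto simp: norm_power power_le_one simp del: power_Suc)
  \<comment> \<open>The factor n gained from (n + 1)! >= n! n supplies the -1 in the final
    exponent.\<close>
  have 2: "(\<lambda>n. norm (inverse (of_nat (fact (Suc n)) :: complex))) \<in> O(\<lambda>n. inverse (fact n * real n))"
  proof (intro bigoI[of _ 1] eventually_mono[OF eventually_gt_at_top[of 0]])
    fix n :: nat assume n: "n > 0"
    have "norm (inverse (of_nat (fact (Suc n)) :: complex)) = inverse (real (Suc n) * fact n)"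
      by (simp only: norm_inverse norm_of_nat) (simp add: field_simps)
    also have "\<dots> \<le> inverse (fact n * real n)"
      using n by (intro le_imp_inverse_le) auto
    finally show "norm (norm (inverse (of_nat (fact (Suc n)) :: complex))) \<le> 1 * norm (inverse (fact n * real n))"
      by simp
  qed
  have "(\<lambda>n. norm (pochL as (Suc n)) * norm (inverse (pochL bs (Suc n))) * norm (z ^ Suc n)
          * norm (inverse (of_nat (fact (Suc n)) :: complex)))
     \<in> O(\<lambda>n. (fact n ^ length as * real n powr Re (sum_list as))
          * inverse (fact n ^ length bs * real n powr Re (sum_list bs)) * 1
          * inverse (fact n * real n))"
    by (intro landau_o.big.mult pochL_Suc_bigo inverse_pochL_Suc_bigo assms(3) 1 2)
  also have "(\<lambda>n. norm (pochL as (Suc n)) * norm (inverse (pochL bs (Suc n))) * norm (z ^ Suc n)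
          * norm (inverse (of_nat (fact (Suc n)) :: complex))) =
     (\<lambda>n. norm (pochL as (Suc n) / pochL bs (Suc n) * z ^ Suc n / of_nat (fact (Suc n))))"
    by (simp add: norm_mult divide_inverse)
  also have "(\<lambda>n. (fact n ^ length as * real n powr Re (sum_list as))
          * inverse (fact n ^ length bs * real n powr Re (sum_list bs)) * 1
          * inverse (fact n * real n)) \<in> \<Theta>(\<lambda>n. real n powr (- \<delta> - 1))"
  proof (intro bigthetaI_cong eventually_mono[OF eventually_gt_at_top[of 0]])
    fix n :: nat assume "n > 0"
    hence "real n powr (- \<delta> - 1) = real n powr Re (sum_list as) / (real n powr Re (sum_list bs) * real n)"
      by (simp add: \<delta>_def powr_diff powr_add powr_minus field_simps)
    with \<open>n > 0\<close> show "(fact n ^ length as * real n powr Re (sum_list as))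
          * inverse (fact n ^ length bs * real n powr Re (sum_list bs)) * 1
          * inverse (fact n * real n) = real n powr (- \<delta> - 1)"
      by (simp add: assms(1) field_simps)
  qed
  finally have "summable (\<lambda>n. norm (pochL as (Suc n) / pochL bs (Suc n) * z ^ Suc n / of_nat (fact (Suc n))))"
    by (rule summable_comparison_test_bigo[rotated])
       (use assms(2) in \<open>simp add: summable_real_powr_iff \<delta>_def\<close>)
  from summable_norm_cancel[OF this] show ?thesis
    using summable_Suc_iff[of "\<lambda>k. pochL as k / pochL bs k * z ^ k / of_nat (fact k)"] by blast
qed

section \<open>Local residues\<close>

lemma sin_pi_add_of_nat: "sin (of_real pi * (x + of_nat k)) = (-1) ^ k * sin (of_real pi * x :: complex)"
proof (induction k)
  case (Suc k)
  have "sin (of_real pi * (x + of_nat (Suc k))) = sin (of_real pi * (x + of_nat k) + of_real pi)"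
    by (simp add: algebra_simps)
  also have "\<dots> = - sin (of_real pi * (x + of_nat k))" by (rule sin_plus_pi)
  finally show ?case using Suc by simp
qed auto

lemma cos_pi_add_of_nat: "cos (of_real pi * (x + of_nat k)) = (-1) ^ k * cos (of_real pi * x :: complex)"
proof (induction k)
  case (Suc k)
  have "cos (of_real pi * (x + of_nat (Suc k))) = cos (of_real pi * (x + of_nat k) + of_real pi)"
    by (simp add: algebra_simps)
  also have "\<dots> = - cos (of_real pi * (x + of_nat k))" by (rule cos_plus_pi)
  finally show ?case using Suc by simp
qed auto

lemma residue_analytic_over_power:
  assumes "f analytic_on {w}"
  shows "residue (\<lambda>t. f t / (t - w)) w = f w" "residue (\<lambda>t. f t / (t - w)\<^sup>2) w = deriv f w"
proof -
  obtain A where A: "open A" "w \<in> A" "f holomorphic_on A"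
    using assms analytic_at by blast
  show "residue (\<lambda>t. f t / (t - w)) w = f w" using residue_simple[OF A] .
  show "residue (\<lambda>t. f t / (t - w)\<^sup>2) w = deriv f w"
    using residue_holomorphic_over_power[OF A, of 1] by (simp add: numeral_2_eq_2)
qed

text \<open>Applying the functional equation k + 1 times extracts the simple factor t - w. The sign
  \<open>\<sigma>\<close> treats poles running to the left and to the right at once.\<close>

lemma residue_Gamma_mult:
  assumes \<sigma>: "\<sigma> = 1 \<or> \<sigma> = -1" and h: "h analytic_on {w}" and w: "c + \<sigma> * w = - of_nat k"
  shows "residue (\<lambda>t. Gamma (c + \<sigma> * t) * h t) w = \<sigma> * (-1) ^ k / fact k * h w"
proof -
  define q where "q = (\<lambda>t. \<sigma> * Gamma (1 + \<sigma> * (t - w)) / pochhammer (\<sigma> * (t - w) - of_nat k) k * h t)"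
  have p0: "pochhammer (- of_nat k :: complex) k = (-1) ^ k * fact k"
    by (rule pochhammer_same)
  have "q analytic_on {w}"
    unfolding q_def by (intro analytic_intros h) (auto simp: p0 pochhammer_prod intro!: analytic_intros)
  \<comment> \<open>This holds even at t = w, where both sides are 0 by the conventions for Gamma at
    its poles and for division by 0.\<close>
  moreover have "Gamma (c + \<sigma> * t) * h t = q t / (t - w)" for t
  proof -
    have "c + \<sigma> * t = \<sigma> * (t - w) - of_nat k" using w by (simp add: algebra_simps eq_neg_iff_add_eq_0)
    hence "rGamma (c + \<sigma> * t) = pochhammer (\<sigma> * (t - w) - of_nat k) (Suc k) * rGamma (1 + \<sigma> * (t - w))"
      using pochhammer_rGamma[of "\<sigma> * (t - w) - of_nat k" "Suc k"] by (simp add: add_ac)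
    also have "\<dots> = pochhammer (\<sigma> * (t - w) - of_nat k) k * (\<sigma> * (t - w)) * rGamma (1 + \<sigma> * (t - w))"
      by (simp add: pochhammer_Suc)
    finally show ?thesis
      using \<sigma> by (auto simp: Gamma_def q_def divide_inverse)
  qed
  ultimately have "residue (\<lambda>t. Gamma (c + \<sigma> * t) * h t) w = q w"
    using residue_analytic_over_power(1)[of q w] by simp
  also have "q w = \<sigma> * (-1) ^ k / fact k * h w"
    by (simp add: q_def p0 field_simps power_mult_distrib[symmetric])
  finally show ?thesis .
qed

text \<open>Reflection turns Gamma(-t) Gamma(1 + t) into -pi / sin(pi t). Squaring produces (t -
  k)^2 and removes the sign (-1)^k; since G has only one factor Gamma(1 + t), the second one is
  compensated by \<open>rGamma (1 + t)\<close>.\<close>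

lemma Gamma_double_pole:
  assumes "t \<noteq> of_nat k"
  shows "Gamma (-t) ^ 2 * Gamma (1 + t) = 
     rGamma (1 + t) * (Gamma (1 + (t - of_nat k)) * Gamma (1 - (t - of_nat k)))\<^sup>2 / (t - of_nat k :: complex)\<^sup>2"
proof -
  define u where "u = t - of_nat k"
  have u: "u \<noteq> 0" and t: "t = u + of_nat k" using assms by (auto simp: u_def)
  have "rGamma u = u * rGamma (u + 1)" by (rule rGamma_plus1[symmetric])
  hence "Gamma (1 + u) = u * Gamma u" using u by (simp add: Gamma_def add.commute)
  hence "Gamma (1 + u) * Gamma (1 - u) = u * (Gamma u * Gamma (1 - u))" by simp
  hence 1: "Gamma (1 + u) * Gamma (1 - u) / u = of_real pi / sin (of_real pi * u)"
    using u by (simp add: Gamma_reflection_complex)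
  have "Gamma (-t) * Gamma (1 + t) = of_real pi / sin (of_real pi * (- t))"
    using Gamma_reflection_complex[of "-t"] by simp
  also have "sin (of_real pi * (- t)) = - ((-1) ^ k * sin (of_real pi * u))"
    by (simp only: t mult_minus_right sin_minus sin_pi_add_of_nat)
  finally have 2: "Gamma (-t) * Gamma (1 + t) = - of_real pi / ((-1) ^ k * sin (of_real pi * u))"
    by simp
  have "Gamma (-t) ^ 2 * Gamma (1 + t) = rGamma (1 + t) * (Gamma (-t) * Gamma (1 + t))\<^sup>2"
  proof -
    have "Gamma (1 + t) = rGamma (1 + t) * (Gamma (1 + t))\<^sup>2"
      by (cases "Gamma (1 + t) = 0") (simp_all add: rGamma_inverse_Gamma power2_eq_square)
    thus ?thesis by (simp add: power_mult_distrib)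
  qed
  also have "(Gamma (-t) * Gamma (1 + t))\<^sup>2 = (Gamma (1 + u) * Gamma (1 - u) / u)\<^sup>2"
    unfolding 1 2 by (simp add: power_divide power_mult_distrib flip: power_mult)
  finally show ?thesis by (simp add: u_def power_divide)
qed

text \<open>In u = t - k the factor (Gamma(1 + u) Gamma(1 - u))^2 is even and equals 1 at u = 0. Its
  derivative vanishes there, so it contributes nothing to the residue.\<close>

lemma residue_Gamma_double_pole:
  assumes "h analytic_on {of_nat k}"
  shows "residue (\<lambda>t. h t * (Gamma (-t) ^ 2 * Gamma (1 + t))) (of_nat k) =
           deriv (\<lambda>t. h t * rGamma (1 + t)) (of_nat k)"
proof -
  define Q where "Q = (\<lambda>t :: complex. (Gamma (1 + (t - of_nat k)) * Gamma (1 - (t - of_nat k)))\<^sup>2)"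
  define g where "g = (\<lambda>t. h t * rGamma (1 + t))"
  have g: "g analytic_on {of_nat k}" unfolding g_def by (intro analytic_intros assms)
  have Q: "Q analytic_on {of_nat k}" unfolding Q_def by (intro analytic_intros) auto
  have "eventually (\<lambda>t. h t * (Gamma (-t) ^ 2 * Gamma (1 + t)) = g t * Q t / (t - of_nat k)\<^sup>2) (at (of_nat k))"
    using eventually_neq_at_within[of "of_nat k"]
    by eventually_elim (simp add: Gamma_double_pole[of _ k] g_def Q_def)
  hence "residue (\<lambda>t. h t * (Gamma (-t) ^ 2 * Gamma (1 + t))) (of_nat k) = 
         residue (\<lambda>t. g t * Q t / (t - of_nat k)\<^sup>2) (of_nat k)"
    by (intro residue_cong) auto
  also have "\<dots> = deriv (\<lambda>t. g t * Q t) (of_nat k)"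
    by (intro residue_analytic_over_power analytic_intros g Q)
  also have "\<dots> = deriv g (of_nat k)"
  proof -
    have "(Q has_field_derivative 0) (at (of_nat k))"
      unfolding Q_def by (auto intro!: derivative_eq_intros)
    moreover have "(g has_field_derivative deriv g (of_nat k)) (at (of_nat k))"
      using g analytic_on_imp_differentiable_at DERIV_deriv_iff_field_differentiable by blast
    ultimately have "((\<lambda>t. g t * Q t) has_field_derivative deriv g (of_nat k) * Q (of_nat k)) (at (of_nat k))"
      by (auto intro!: derivative_eq_intros)
    moreover have "Q (of_nat k) = 1" by (simp add: Q_def)
    ultimately show ?thesis by (simp add: DERIV_imp_deriv)
  qed
  finally show ?thesis by (simp add: g_def)
qed

text \<open>Each derivative is given through a logarithmic derivative L, because these add up under
  products; for Gamma factors they are digamma values.\<close>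

lemma DERIV_prod_list_log:
  fixes f :: "'a \<Rightarrow> complex \<Rightarrow> complex"
  assumes "\<And>x. x \<in> set xs \<Longrightarrow> (f x has_field_derivative f x w * L x) (at w)"
  shows "((\<lambda>t. \<Prod>x\<leftarrow>xs. f x t) has_field_derivative (\<Prod>x\<leftarrow>xs. f x w) * (\<Sum>x\<leftarrow>xs. L x)) (at w)"
  using assms
proof (induction xs)
  case (Cons x xs)
  have "((\<lambda>t. f x t * (\<Prod>y\<leftarrow>xs. f y t)) has_field_derivative 
     f x w * ((\<Prod>y\<leftarrow>xs. f y w) * (\<Sum>x\<leftarrow>xs. L x)) + f x w * L x * (\<Prod>y\<leftarrow>xs. f y w)) (at w)"
    by (intro DERIV_mult' Cons) (use Cons.prems in auto)
  thus ?case by (simp add: algebra_simps)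
qed auto

lemma analytic_on_prod_list [analytic_intros]:
  fixes f :: "'a \<Rightarrow> complex \<Rightarrow> complex"
  assumes "\<And>x. x \<in> set xs \<Longrightarrow> f x analytic_on A"
  shows "(\<lambda>t. \<Prod>x\<leftarrow>xs. f x t) analytic_on A"
  using assms by (induction xs) (auto intro!: analytic_intros)

text \<open>The product Gamma(w) Gamma(1 - w) sin(pi w) is constant off the integers. Its derivative
  is therefore 0, and the nonzero Gamma factors can be divided out.\<close>

lemma Digamma_reflection_complex:
  fixes w :: complex
  assumes "w \<notin> \<int>"
  shows "Digamma (1 - w) = Digamma w + of_real pi * cot (of_real pi * w)"
proof -
  have w: "w \<notin> \<int>\<^sub>\<le>\<^sub>0" "1 - w \<notin> \<int>\<^sub>\<le>\<^sub>0"
    using assms nonpos_Ints_Int Ints_diff[of 1 "1 - w"] by fastforce+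
  have s: "sin (of_real pi * w) \<noteq> 0"
    using assms sin_eq_0[of "of_real pi * w"] by (auto simp: field_simps)
  define D where "D = Gamma w * Gamma (1 - w) * 
     ((Digamma w - Digamma (1 - w)) * sin (of_real pi * w) + of_real pi * cos (of_real pi * w))"
  have "((\<lambda>w. Gamma w * Gamma (1 - w) * sin (of_real pi * w)) has_field_derivative D) (at w)"
    using w unfolding D_def by (auto intro!: derivative_eq_intros simp: algebra_simps)
  moreover have "((\<lambda>w. Gamma w * Gamma (1 - w) * sin (of_real pi * w)) has_field_derivative 0) (at w)"
  proof (rule has_field_derivative_transform_within_open)
    show "((\<lambda>_. of_real pi) has_field_derivative 0) (at w)" by simp
    show "open (- \<int> :: complex set)" using closed_Ints by (simp add: open_Compl)
    show "of_real pi = Gamma z * Gamma (1 - z) * sin (of_real pi * z)" if "z \<in> - \<int>" for z :: complex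
      using that sin_eq_0[of "of_real pi * z"] by (auto simp: Gamma_reflection_complex)
  qed (use assms in auto)
  ultimately have "D = 0" by (rule DERIV_unique)
  moreover have "Gamma w \<noteq> 0" "Gamma (1 - w) \<noteq> 0" using w by (simp_all add: Gamma_eq_zero_iff)
  ultimately have "(Digamma w - Digamma (1 - w)) * sin (of_real pi * w) + of_real pi * cos (of_real pi * w) = 0"
    by (simp add: D_def)
  thus ?thesis using s by (simp add: cot_def field_simps)
qed

section \<open>Summing residues over growing rectangles\<close>

lemma contour_integral_rectpath_bound:
  assumes "continuous_on (path_image (rectpath a b)) f" "Re a \<le> Re b" "Im a \<le> Im b" "B \<ge> 0"
    and "\<And>t. t \<in> path_image (rectpath a b) \<Longrightarrow> norm (f t) \<le> B"
  shows "norm (contour_integral (rectpath a b) f) \<le> B * (2 * (Re b - Re a) + 2 * (Im b - Im a))"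
proof -
  define c d where "c = Complex (Re b) (Im a)" and "d = Complex (Re a) (Im b)"
  have rp: "rectpath a b = linepath a c +++ linepath c b +++ linepath b d +++ linepath d a"
    by (simp add: rectpath_def c_def d_def Let_def)
  have pi: "path_image (rectpath a b) = closed_segment a c \<union> closed_segment c b \<union> closed_segment b d \<union> closed_segment d a"
    unfolding rp by (simp add: path_image_join Un_assoc)
  have int: "f contour_integrable_on linepath x y" 
     "norm (contour_integral (linepath x y) f) \<le> B * norm (y - x)" 
    if "closed_segment x y \<subseteq> path_image (rectpath a b)" for x y
  proof -
    show "f contour_integrable_on linepath x y"
      using assms(1) that by (intro contour_integrable_continuous_linepath) (rule continuous_on_subset)
    thus "norm (contour_integral (linepath x y) f) \<le> B * norm (y - x)"
      using assms(4,5) that by (intro contour_integral_bound_linepath) auto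
  qed
  note seg = int[of a c] int[of c b] int[of b d] int[of d a]
  have "contour_integral (rectpath a b) f = contour_integral (linepath a c) f + (contour_integral (linepath c b) f
     + (contour_integral (linepath b d) f + contour_integral (linepath d a) f))"
    unfolding rp using seg(1,3,5,7) pi by (simp add: contour_integrable_join Un_assoc subset_iff)
  also have "norm \<dots> \<le> B * norm (c - a) + (B * norm (b - c) + (B * norm (d - b) + B * norm (a - d)))"
    using seg(2,4,6,8) pi by (intro norm_triangle_mono) auto
  also have "norm (c - a) = Re b - Re a"
    using assms(2) by (simp add: c_def cmod_def)
  also have "norm (b - c) = Im b - Im a"
    using assms(3) by (simp add: c_def cmod_def)
  also have "norm (d - b) = Re b - Re a"
    using assms(2) by (simp add: d_def cmod_def)
  also have "norm (a - d) = Im b - Im a"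
    using assms(3) by (simp add: d_def cmod_def)
  finally show ?thesis by (simp add: algebra_simps)
qed

text \<open>For \<open>\<sigma>\<close> = 1 or -1 and N > |Re c - \<open>\<theta>\<close>| this is
  the number of k >= 0 for which c + \<open>\<sigma>\<close> k lies strictly between the vertical
  sides of the N-th rectangle. The ceiling turns the strict real bound into an exact bound on
  naturals.\<close>

definition pole_count :: "real \<Rightarrow> complex \<Rightarrow> complex \<Rightarrow> nat \<Rightarrow> nat" where
  "pole_count \<theta> c \<sigma> N = nat \<lceil>real N + Re \<sigma> * (\<theta> - Re c)\<rceil>"

lemma less_pole_count_iff: "k < pole_count \<theta> c \<sigma> N \<longleftrightarrow> real k < real N + Re \<sigma> * (\<theta> - Re c)"
  unfolding pole_count_def by linarith

lemma filterlim_pole_count: "filterlim (pole_count \<theta> c \<sigma>) at_top sequentially"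
  unfolding filterlim_at_top
proof
  fix Z
  show "eventually (\<lambda>N. Z \<le> pole_count \<theta> c \<sigma> N) sequentially"
    using eventually_ge_at_top[of "nat \<lceil>real Z - Re \<sigma> * (\<theta> - Re c)\<rceil>"]
    by eventually_elim (unfold pole_count_def, linarith)
qed

text \<open>By the residue theorem the sum is the contour integral divided by 2 pi i, and the
  perimeter 8 N times C N^\<open>\<alpha>\<close> tends to 0. Injectivity ensures that no pole is
  counted twice.\<close>

lemma residues_rect_tendsto_0:
  fixes c \<sigma> :: "'j \<Rightarrow> complex"
  assumes fin: "finite J" and \<sigma>: "\<And>j. j \<in> J \<Longrightarrow> \<sigma> j = 1 \<or> \<sigma> j = -1"
    and inj: "inj_on (\<lambda>(j, k). c j + \<sigma> j * of_nat k) (J \<times> UNIV)"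
    and holo: "f holomorphic_on - (\<lambda>(j, k). c j + \<sigma> j * of_nat k) ` (J \<times> UNIV)"
    and \<theta>: "\<And>j. j \<in> J \<Longrightarrow> \<theta> - Re (c j) \<notin> \<int>"
    and bound: "eventually (\<lambda>N. \<forall>t\<in>path_image (rect \<theta> N). norm (f t) \<le> C * real N powr \<alpha>) sequentially"
    and \<alpha>: "\<alpha> < -1" and C: "C \<ge> 0"
  shows "(\<lambda>N. \<Sum>j\<in>J. \<Sum>k<pole_count \<theta> (c j) (\<sigma> j) N. residue f (c j + \<sigma> j * of_nat k)) \<longlonglongrightarrow> 0"
proof (rule Lim_null_comparison)
  define pole where "pole = (\<lambda>(j, k). c j + \<sigma> j * of_nat k)"
  define P where "P = pole ` (J \<times> UNIV)"
  have ev: "eventually (\<lambda>N. \<forall>j\<in>J. real N \<ge> norm (c j) + \<bar>\<theta>\<bar> + 1) sequentially"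
    using fin by (intro eventually_ball_finite ballI filterlim_real_sequentially[unfolded filterlim_at_top, rule_format])
  show "eventually (\<lambda>N. norm (\<Sum>j\<in>J. \<Sum>k<pole_count \<theta> (c j) (\<sigma> j) N. residue f (c j + \<sigma> j * of_nat k))
      \<le> 8 * C / (2 * pi) * (real N powr (1 + \<alpha>))) sequentially"
    using ev bound eventually_gt_at_top[of 0]
  proof eventually_elim
    case (elim N)
    define a b where "a = Complex (\<theta> - real N) (- real N)" and "b = Complex (\<theta> + real N) (real N)"
    have rect: "rect \<theta> N = rectpath a b" by (simp add: rect_def a_def b_def)
    have ab: "Re a \<le> Re b" "Im a \<le> Im b" "Re a < Re b" "Im a < Im b" using elim(3) by (auto simp: a_def b_def)
    have cN: "\<bar>Im (c j)\<bar> < real N" "\<bar>Re (c j) - \<theta>\<bar> < real N" if "j \<in> J" for j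
      using elim(1) that abs_Re_le_cmod[of "c j"] abs_Im_le_cmod[of "c j"] by fastforce+
    \<comment> \<open>Modulo 1 the vertical sides have real part \<open>\<theta>\<close> and the
      poles Re (c j); the horizontal sides lie beyond every |Im (c j)|.\<close>
    have off: "P \<inter> path_image (rect \<theta> N) = {}"
    proof -
      have "pole (j, k) \<notin> path_image (rect \<theta> N)" if j: "j \<in> J" for j k
      proof
        assume "pole (j, k) \<in> path_image (rect \<theta> N)"
        hence *: "Re (pole (j, k)) = \<theta> - real N \<or> Re (pole (j, k)) = \<theta> + real N \<or> \<bar>Im (pole (j, k))\<bar> = real N"
          using path_image_rect by blast
        have "Im (pole (j, k)) = Im (c j)" using \<sigma>[OF j] by (auto simp: pole_def)
        moreover obtain i where "Re (pole (j, k)) = Re (c j) + of_int i" 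
          using \<sigma>[OF j] by (auto simp: pole_def intro: that[of "int k"] that[of "- int k"])
        ultimately have "\<theta> - Re (c j) = of_int (i + int N) \<or> \<theta> - Re (c j) = of_int (i - int N)"
          using * cN[OF j] by auto
        thus False using \<theta>[OF j] by (metis Ints_of_int)
      qed
      thus ?thesis by (auto simp: P_def)
    qed
    \<comment> \<open>The residue theorem is applied in a ball with finitely many singularities.
      This one contains the closed rectangle, as |t| <= |Re t| + |Im t| <= |\<open>\<theta>\<close>|
      + 2 N < R. Poles in the ball but outside the rectangle have winding number 0.\<close>
    define R where "R = 3 * real N + \<bar>\<theta>\<bar> + 1"
    define pts where "pts = P \<inter> ball 0 R"
    have cbox: "cbox a b \<subseteq> ball 0 R"
    proof
      fix t assume "t \<in> cbox a b"
      hence "\<bar>Re t\<bar> \<le> \<bar>\<theta>\<bar> + real N" "\<bar>Im t\<bar> \<le> real N" by (auto simp: a_def b_def in_cbox_complex_iff)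
      thus "t \<in> ball 0 R" using cmod_le[of t] elim(3) by (simp add: R_def)
    qed
    have box: "box a b \<subseteq> ball 0 R" using box_subset_cbox cbox by blast
    have fin_pts: "finite pts"
    proof (rule finite_subset)
      show "pts \<subseteq> pole ` (SIGMA j:J. {..<nat \<lceil>R + norm (c j)\<rceil>})"
      proof
        fix t assume "t \<in> pts"
        then obtain j k where t: "t = pole (j, k)" "j \<in> J" "norm t < R" by (auto simp: pts_def P_def)
        have "of_nat k = \<sigma> j * (t - c j)" using \<sigma>[OF t(2)] by (auto simp: t(1) pole_def)
        hence "real k = norm (\<sigma> j * (t - c j))" by (metis norm_of_nat)
        also have "\<dots> = norm (t - c j)" using \<sigma>[OF t(2)] by (auto simp: norm_minus_commute)
        also have "\<dots> \<le> norm t + norm (c j)" by (rule norm_triangle_ineq4)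
        finally have "k < nat \<lceil>R + norm (c j)\<rceil>" using t(3) by linarith
        thus "t \<in> pole ` (SIGMA j:J. {..<nat \<lceil>R + norm (c j)\<rceil>})" using t by blast
      qed
      show "finite (pole ` (SIGMA j:J. {..<nat \<lceil>R + norm (c j)\<rceil>}))"
        using fin by (intro finite_imageI finite_SigmaI) auto
    qed
    have "contour_integral (rectpath a b) f = 2 * pi * \<i> * (\<Sum>p\<in>pts. winding_number (rectpath a b) p * residue f p)"
    proof (rule Residue_theorem)
      show "f holomorphic_on ball 0 R - pts"
        by (rule holomorphic_on_subset[OF holo]) (auto simp: pts_def P_def pole_def)
      show "path_image (rectpath a b) \<subseteq> ball 0 R - pts"
        using off path_image_rectpath_subset_cbox[OF ab(1,2)] cbox by (auto simp: rect pts_def)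
      show "\<forall>z. z \<notin> ball 0 R \<longrightarrow> winding_number (rectpath a b) z = 0"
        using cbox ab by (auto intro!: winding_number_rectpath_outside)
    qed (use fin_pts in auto)
    also have "(\<Sum>p\<in>pts. winding_number (rectpath a b) p * residue f p) = (\<Sum>p\<in>P \<inter> box a b. residue f p)"
    proof (rule sum.mono_neutral_cong_right[OF fin_pts])
      show "P \<inter> box a b \<subseteq> pts" using box by (auto simp: pts_def)
      show "\<forall>p\<in>pts - P \<inter> box a b. winding_number (rectpath a b) p * residue f p = 0"
      proof
        fix p assume "p \<in> pts - P \<inter> box a b"
        hence "p \<notin> cbox a b"
          using off unfolding rect path_image_rectpath_cbox_minus_box[OF ab(1,2)] by (auto simp: pts_def)
        hence "winding_number (rectpath a b) p = 0"
          using ab by (intro winding_number_rectpath_outside)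
        thus "winding_number (rectpath a b) p * residue f p = 0" by simp
      qed
    qed (auto simp: winding_number_rectpath)
    also have "P \<inter> box a b = pole ` (SIGMA j:J. {..<pole_count \<theta> (c j) (\<sigma> j) N})"
    proof -
      have "pole (j, k) \<in> box a b \<longleftrightarrow> k < pole_count \<theta> (c j) (\<sigma> j) N" if j: "j \<in> J" for j k
        using cN[OF j] \<sigma>[OF j] 
        by (auto simp: less_pole_count_iff pole_def in_box_complex_iff a_def b_def)
      thus ?thesis by (force simp: P_def)
    qed
    also have "(\<Sum>p\<in>pole ` (SIGMA j:J. {..<pole_count \<theta> (c j) (\<sigma> j) N}). residue f p)
       = (\<Sum>x\<in>(SIGMA j:J. {..<pole_count \<theta> (c j) (\<sigma> j) N}). residue f (pole x))"
      by (subst sum.reindex) (auto intro: inj_on_subset[OF inj] simp: pole_def)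
    also have "\<dots> = (\<Sum>j\<in>J. \<Sum>k<pole_count \<theta> (c j) (\<sigma> j) N. residue f (c j + \<sigma> j * of_nat k))"
      using fin by (subst sum.Sigma) (auto simp: pole_def case_prod_unfold)
    finally have eq: "contour_integral (rectpath a b) f = 2 * pi * \<i> * \<dots>" .
    have "norm (contour_integral (rectpath a b) f) 
        \<le> C * real N powr \<alpha> * (2 * (Re b - Re a) + 2 * (Im b - Im a))"
    proof (rule contour_integral_rectpath_bound[OF _ ab(1,2)])
      show "continuous_on (path_image (rectpath a b)) f"
        using off by (intro holomorphic_on_imp_continuous_on holomorphic_on_subset[OF holo]) 
           (auto simp: rect P_def pole_def)
    qed (use elim(2) C rect in auto)
    also have "\<dots> = 8 * C * real N powr (1 + \<alpha>)"
      using elim(3) by (simp add: a_def b_def powr_add algebra_simps)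
    finally show ?case unfolding eq norm_mult by (simp add: field_simps)
  qed
  have "(\<lambda>N. real N powr (1 + \<alpha>)) \<longlonglongrightarrow> 0"
    using \<alpha> by (intro tendsto_neg_powr filterlim_real_sequentially) auto
  from tendsto_mult_right_zero[OF this]
  show "(\<lambda>N. 8 * C / (2 * pi) * (real N powr (1 + \<alpha>))) \<longlonglongrightarrow> 0" .
qed

text \<open>Convergence at \<open>j0\<close> is part of the conclusion: the total residue sums tend
  to 0 and the other families are summable, so their difference, a sequence of partial sums for
  \<open>j0\<close>, converges.\<close>

lemma residue_series_sums:
  fixes c \<sigma> :: "'j \<Rightarrow> complex"
  assumes "finite J" "\<And>j. j \<in> J \<Longrightarrow> \<sigma> j = 1 \<or> \<sigma> j = -1"
    and "inj_on (\<lambda>(j, k). c j + \<sigma> j * of_nat k) (J \<times> UNIV)"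
    and "f holomorphic_on - (\<lambda>(j, k). c j + \<sigma> j * of_nat k) ` (J \<times> UNIV)"
    and "\<And>j. j \<in> J \<Longrightarrow> \<theta> - Re (c j) \<notin> \<int>"
    and "eventually (\<lambda>N. \<forall>t\<in>path_image (rect \<theta> N). norm (f t) \<le> C * real N powr \<alpha>) sequentially"
    and "\<alpha> < -1" "C \<ge> 0"
    and j0: "j0 \<in> J" "c j0 = 0" "\<sigma> j0 = 1" "0 < \<theta>" "\<theta> < 1"
    and summ: "\<And>j. j \<in> J - {j0} \<Longrightarrow> summable (\<lambda>k. residue f (c j + \<sigma> j * of_nat k))"
  shows "(\<lambda>k. residue f (of_nat k)) sums (- (\<Sum>j\<in>J-{j0}. \<Sum>k. residue f (c j + \<sigma> j * of_nat k)))"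
proof -
  define r where "r = (\<lambda>j k. residue f (c j + \<sigma> j * of_nat k))"
  have "(\<lambda>N. \<Sum>k<pole_count \<theta> (c j) (\<sigma> j) N. r j k) \<longlonglongrightarrow> (\<Sum>k. r j k)" if "j \<in> J - {j0}" for j
    using summ[OF that] unfolding r_def
    by (intro filterlim_compose[OF summable_LIMSEQ filterlim_pole_count])
  hence "(\<lambda>N. (\<Sum>j\<in>J. \<Sum>k<pole_count \<theta> (c j) (\<sigma> j) N. r j k)
      - (\<Sum>j\<in>J-{j0}. \<Sum>k<pole_count \<theta> (c j) (\<sigma> j) N. r j k)) \<longlonglongrightarrow> 0 - (\<Sum>j\<in>J-{j0}. \<Sum>k. r j k)"
    using residues_rect_tendsto_0[OF assms(1-8)] unfolding r_def
    by (intro tendsto_diff tendsto_sum)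
  also have "(\<lambda>N. (\<Sum>j\<in>J. \<Sum>k<pole_count \<theta> (c j) (\<sigma> j) N. r j k)
      - (\<Sum>j\<in>J-{j0}. \<Sum>k<pole_count \<theta> (c j) (\<sigma> j) N. r j k)) = (\<lambda>N. \<Sum>k<Suc N. r j0 k)"
  proof
    fix N
    \<comment> \<open>For center 0 and 0 < \<open>\<theta>\<close> < 1 the bound k < N +
      \<open>\<theta>\<close> means k <= N. So every nonempty partial sum occurs exactly once, which
      gives a limit along the full sequence.\<close>
    have "pole_count \<theta> (c j0) (\<sigma> j0) N = Suc N"
      using j0 unfolding pole_count_def by simp linarith
    thus "(\<Sum>j\<in>J. \<Sum>k<pole_count \<theta> (c j) (\<sigma> j) N. r j k)
      - (\<Sum>j\<in>J-{j0}. \<Sum>k<pole_count \<theta> (c j) (\<sigma> j) N. r j k) = (\<Sum>k<Suc N. r j0 k)"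
      using assms(1) j0(1) by (simp add: sum.remove)
  qed
  finally show ?thesis
    using j0 unfolding sums_def r_def filterlim_sequentially_Suc[of "\<lambda>N. \<Sum>k<N. residue f (c j0 + \<sigma> j0 * of_nat k)"] by simp
qed

section \<open>The four families of poles\<close>

lemma add_of_nat_notin_nonpos_Ints: "x \<notin> \<int>\<^sub>\<le>\<^sub>0 \<Longrightarrow> x + of_nat k \<notin> \<int>\<^sub>\<le>\<^sub>0" for x :: complex
proof
  assume "x \<notin> \<int>\<^sub>\<le>\<^sub>0" "x + of_nat k \<in> \<int>\<^sub>\<le>\<^sub>0"
  then obtain n :: nat where "x + of_nat k = - of_nat n" by (elim nonpos_Ints_cases') 
  hence "x = - of_nat (n + k)" by (simp add: algebra_simps eq_neg_iff_add_eq_0)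
  hence "x \<in> \<int>\<^sub>\<le>\<^sub>0" by (metis minus_of_nat_in_nonpos_Ints)
  with \<open>x \<notin> \<int>\<^sub>\<le>\<^sub>0\<close> show False by simp
qed

section \<open>Integer shifts of Gamma factors and of products over parameter lists\<close>

lemma Gamma_add_of_nat:
  "x \<notin> \<int>\<^sub>\<le>\<^sub>0 \<Longrightarrow> Gamma (x + of_nat k) = Gamma x * pochhammer x k" for x :: complex
  by (simp add: pochhammer_Gamma Gamma_eq_zero_iff)

lemma rGamma_diff_of_nat:
  "rGamma (x - of_nat k) = (-1) ^ k * pochhammer (1 - x) k * rGamma x" for x :: complex
proof -
  have "rGamma (x - of_nat k) = pochhammer (- (of_nat k - x)) k * rGamma x"
    using pochhammer_rGamma[of "x - of_nat k" k] by simp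
  also have "pochhammer (- (of_nat k - x)) k = (-1) ^ k * pochhammer (1 - x) k"
    by (subst pochhammer_minus) (simp add: algebra_simps)
  finally show ?thesis .
qed

text \<open>This is the reciprocal of an identity between entire functions, hence valid for every x:
  at zeros both sides are 0 by convention.\<close>

lemma Gamma_diff_of_nat:
  "Gamma (x - of_nat k) = (-1) ^ k * Gamma x / pochhammer (1 - x) k" for x :: complex
  by (simp add: Gamma_def rGamma_diff_of_nat divide_inverse mult_ac flip: power_inverse)

lemma GammaL_simps [simp]:
  "GammaL [] = 1" "GammaL (x # xs) = Gamma x * GammaL xs" "GammaL (xs @ ys) = GammaL xs * GammaL ys"
  by (simp_all add: GammaL_def)

lemma pochL_simps [simp]:
  "pochL [] k = 1" "pochL (x # xs) k = pochhammer x k * pochL xs k" "pochL (xs @ ys) k = pochL xs k * pochL ys k"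
  by (simp_all add: pochL_def)

lemma GammaL_nonzero: "(\<And>x. x \<in> set xs \<Longrightarrow> x \<notin> \<int>\<^sub>\<le>\<^sub>0) \<Longrightarrow> GammaL xs \<noteq> 0"
  by (induction xs) (auto simp: Gamma_eq_zero_iff)

text \<open>Splitting off the first factor of each symbol is the origin of the coefficient (1-b)_1 /
  (1-a)_1 and of the shift from 1 - x to 2 - x in the series over the negative integers.\<close>

lemma pochL_Suc: "pochL (map f xs) (Suc k) = pochL (map f xs) 1 * pochL (map (\<lambda>x. f x + 1) xs) k"
  by (induction xs) (auto simp: pochhammer_rec)

lemma prod_list_Gamma_add_of_nat:
  "(\<And>x. x \<in> set xs \<Longrightarrow> f x \<notin> \<int>\<^sub>\<le>\<^sub>0) \<Longrightarrow>
     (\<Prod>x\<leftarrow>xs. Gamma (f x + of_nat k)) = GammaL (map f xs) * pochL (map f xs) k"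
  by (induction xs) (auto simp: Gamma_add_of_nat)

lemma prod_list_rGamma_add_of_nat:
  "(\<And>x. x \<in> set xs \<Longrightarrow> f x \<notin> \<int>\<^sub>\<le>\<^sub>0) \<Longrightarrow>
     (\<Prod>x\<leftarrow>xs. rGamma (f x + of_nat k)) = 1 / (GammaL (map f xs) * pochL (map f xs) k)"
  by (induction xs) (auto simp: rGamma_inverse_Gamma Gamma_add_of_nat divide_inverse)

lemma prod_list_Gamma_diff_of_nat:
  "(\<Prod>x\<leftarrow>xs. Gamma (f x - of_nat k)) = 
     ((-1) ^ k) ^ length xs * GammaL (map f xs) / pochL (map (\<lambda>x. 1 - f x) xs) k"
  by (induction xs) (auto simp: Gamma_diff_of_nat)

lemma prod_list_rGamma_diff_of_nat:
  "(\<Prod>x\<leftarrow>xs. rGamma (f x - of_nat k)) =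
     ((-1) ^ k) ^ length xs * pochL (map (\<lambda>x. 1 - f x) xs) k / GammaL (map f xs)"
proof (induction xs)
  case (Cons x xs)
  show ?case using Cons
    by (simp add: rGamma_diff_of_nat) (simp add: rGamma_inverse_Gamma divide_inverse mult_ac)
qed auto

lemma prod_list_del_nth:
  fixes f :: "'a \<Rightarrow> complex"
  assumes "i < length xs"
  shows "(\<Prod>x\<leftarrow>xs. f x) = f (xs ! i) * (\<Prod>x\<leftarrow>del_nth i xs. f x)"
  by (subst id_take_nth_drop[OF assms]) (simp add: del_nth_def)

lemma sum_list_del_nth:
  fixes xs :: "complex list"
  assumes "i < length xs"
  shows "sum_list (del_nth i xs) = sum_list xs - xs ! i"
  by (subst (2) id_take_nth_drop[OF assms]) (simp add: del_nth_def)

lemma length_del_nth: "i < length xs \<Longrightarrow> Suc (length (del_nth i xs)) = length xs"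
  by (simp add: del_nth_def)

lemma in_set_del_nth:
  assumes "x \<in> set (del_nth i xs)"
  obtains j where "j < length xs" "j \<noteq> i" "x = xs ! j"
proof -
  consider "x \<in> set (take i xs)" | "x \<in> set (drop (Suc i) xs)"
    using assms by (auto simp: del_nth_def)
  thus ?thesis
  proof cases
    case 1
    then obtain j where "j < length xs" "j < i" "x = xs ! j" by (auto simp: in_set_conv_nth)
    thus ?thesis by (intro that[of j]) auto
  next
    case 2
    then obtain j where "j < length (drop (Suc i) xs)" "x = drop (Suc i) xs ! j"
      unfolding in_set_conv_nth by blast
    thus ?thesis by (intro that[of "Suc i + j"]) auto
  qed
qed

lemma sum_list_map_affine:
  fixes xs :: "complex list"
  shows "sum_list (map (\<lambda>x. c - x) xs) = of_nat (length xs) * c - sum_list xs"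
    and "sum_list (map (\<lambda>x. c - x + d) xs) = of_nat (length xs) * (c + d) - sum_list xs"
    and "sum_list (map (\<lambda>x. c + x) xs) = of_nat (length xs) * c + sum_list xs"
  by (induction xs) (auto simp: algebra_simps)

text \<open>The numbers p, n, s are eliminated in favour of list lengths: \<open>length_eq\<close>
  says that there is one more upper than lower parameter, and \<open>length_le\<close> is the
  condition s - n >= -2.\<close>

locale barnes_data =
  fixes a1 a2 b1 b2 :: "complex list"
  assumes length_eq: "length a1 + length a2 = Suc (length b1 + length b2)"
    and length_le: "length a1 \<le> length b1 + 2"
    and a1_nonint: "\<forall>x\<in>set a1. x \<notin> \<int>"
    and b1_nonint: "\<forall>x\<in>set b1. x \<notin> \<int>"
    and Re_pos: "Re (sum_list (b1 @ b2) - sum_list (a1 @ a2)) > 0"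
    and a2_nonint: "\<forall>x\<in>set a2. x \<notin> \<int>"
    and a2_distinct: "\<forall>i<length a2. \<forall>j<length a2. i \<noteq> j \<longrightarrow> a2 ! i - a2 ! j \<notin> \<int>"
    and b1_distinct: "\<forall>i<length b1. \<forall>j<length b1. i \<noteq> j \<longrightarrow> b1 ! i - b1 ! j \<notin> \<int>"
    and b2_gen: "\<forall>x\<in>set b2. x \<notin> \<int>\<^sub>\<le>\<^sub>0"
    and a2k_gen: "\<forall>i<length a2.
         (\<forall>x\<in>set b1. 1 - x + a2 ! i \<notin> \<int>\<^sub>\<le>\<^sub>0) \<and>
         (\<forall>x\<in>set b2. x - a2 ! i \<notin> \<int>\<^sub>\<le>\<^sub>0) \<and>
         (\<forall>x\<in>set a1. 1 - x + a2 ! i \<notin> \<int>\<^sub>\<le>\<^sub>0)"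
    and b1k_gen: "\<forall>i<length b1.
         (\<forall>x\<in>set a2. 1 - b1 ! i + x \<notin> \<int>\<^sub>\<le>\<^sub>0) \<and>
         (\<forall>x\<in>set a1. b1 ! i - x \<notin> \<int>\<^sub>\<le>\<^sub>0) \<and>
         (\<forall>x\<in>set b2. 1 - b1 ! i + x \<notin> \<int>\<^sub>\<le>\<^sub>0)"
begin

abbreviation "a \<equiv> a1 @ a2"
abbreviation "b \<equiv> b1 @ b2"

definition z :: complex where "z = (-1) ^ (length a1 + length b1)"

text \<open>This is the value at t = 0 of the integrand without Gamma(-t)^2 Gamma(1 + t). Its
  reciprocal is the factor in front of both finite sums of the theorem.\<close>

definition D :: complex where
  "D = GammaL a2 * GammaL (map (\<lambda>x. 1 - x) b1) / (GammaL (map (\<lambda>x. 1 - x) a1) * GammaL b2)"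

abbreviation "G \<equiv> barnes_integrand a1 a2 b1 b2"

lemma notin_nonpos_IntsI: "x \<notin> \<int> \<Longrightarrow> x \<notin> \<int>\<^sub>\<le>\<^sub>0" for x :: complex
  using nonpos_Ints_Int by blast

lemma Ints_shift:
  "(1 - x - of_nat k \<in> \<int>) = (x \<in> \<int>)" "(x + of_nat k \<in> \<int>) = (x \<in> \<int>)" "(1 - x \<in> \<int>) = (x \<in> \<int>)"
  "(x - of_nat k \<in> \<int>) = (x \<in> \<int>)" "(x - 1 - of_nat k \<in> \<int>) = (x \<in> \<int>)"
  "(2 - x + of_nat k \<in> \<int>) = (x \<in> \<int>)" "(2 - x \<in> \<int>) = (x \<in> \<int>)" for x :: complex
proof -
  show 2: "(x + of_nat k \<in> \<int>) = (x \<in> \<int>)" for x :: complex and k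
    by (metis Ints_add Ints_diff Ints_of_nat add_diff_cancel_right')
  show 3: "(x - of_nat k \<in> \<int>) = (x \<in> \<int>)" for x :: complex and k
    by (metis 2 diff_add_cancel)
  show 4: "(1 - x \<in> \<int>) = (x \<in> \<int>)" for x :: complex
    by (metis Ints_1 Ints_diff diff_diff_eq2 add_diff_cancel_left')
  show "(1 - x - of_nat k \<in> \<int>) = (x \<in> \<int>)" by (simp add: 3 4)
  show "(x - 1 - of_nat k \<in> \<int>) = (x \<in> \<int>)" using 3[of x 1] by (simp add: 3)
  show 5: "(2 - x \<in> \<int>) = (x \<in> \<int>)" using 2[of "1 - x" 1] by (simp add: 4)
  show "(2 - x + of_nat k \<in> \<int>) = (x \<in> \<int>)" by (simp add: 2 5)
qed

lemma cot_pi_add_of_nat: "cot (of_real pi * (x + of_nat k)) = cot (of_real pi * x :: complex)"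
  by (simp add: cot_def sin_pi_add_of_nat cos_pi_add_of_nat)

lemma z_power: "z ^ k = ((-1) ^ k) ^ length a1 * ((-1) ^ k) ^ length b1"
  by (simp add: z_def power_add power_mult_distrib flip: power_mult) (simp add: mult.commute)

text \<open>Shifts to the right produce signs from a1 and b1, shifts to the left from a2 and b2. By
  \<open>length_eq\<close> the two parities differ by one, which leaves an extra (-1)^k for poles on
  the left; the alternating residues of Gamma absorb it.\<close>

lemma neg_one_power_length:
  "((-1) ^ k) ^ length a2 * ((-1) ^ k) ^ length b2 = (-1) ^ k * z ^ k"
proof -
  define e :: complex where "e = (-1) ^ k"
  have ee: "e * e = 1" by (simp add: e_def flip: power_mult_distrib)
  have sq: "e ^ n * e ^ n = 1" for n by (simp add: ee flip: power_mult_distrib)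
  have "e ^ length a1 * e ^ length a2 = e * (e ^ length b1 * e ^ length b2)"
    using length_eq by (simp flip: power_add power_Suc)
  hence "(e ^ length a1 * e ^ length a1) * e ^ length a2 * e ^ length b2
      = e * e ^ length a1 * e ^ length b1 * (e ^ length b2 * e ^ length b2)"
    by (simp add: mult_ac)
  thus ?thesis unfolding z_power by (simp add: sq mult_ac flip: e_def)
qed

lemma D_nonzero: "D \<noteq> 0"
proof -
  have "GammaL b2 \<noteq> 0" using b2_gen by (intro GammaL_nonzero) auto
  moreover have "GammaL a2 \<noteq> 0" "GammaL (map (\<lambda>x. 1 - x) b1) \<noteq> 0" "GammaL (map (\<lambda>x. 1 - x) a1) \<noteq> 0"
    using a1_nonint a2_nonint b1_nonint by (auto simp: Ints_shift intro!: GammaL_nonzero notin_nonpos_IntsI)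
  ultimately show ?thesis by (simp add: D_def)
qed

text \<open>The residue is the derivative of a product of Gamma factors, that is, its value times a
  sum of digammas. The value is D times the hypergeometric term, and the digammas at 1 - x - k are
  reflected to x + k at the price of cotangents.\<close>

lemma residue_nonneg:
  "residue G (of_nat k) = D * (pochL a k / pochL b k * z ^ k / of_nat (fact k)) *
     (of_real pi * ((\<Sum>x\<leftarrow>a1. cot (of_real pi * x)) - (\<Sum>x\<leftarrow>b1. cot (of_real pi * x)))
      - ((\<Sum>x\<leftarrow>b. Digamma (x + of_nat k)) + Digamma (1 + of_nat k) - (\<Sum>x\<leftarrow>a. Digamma (x + of_nat k))))"
proof -
  define h where "h = (\<lambda>t. (\<Prod>x\<leftarrow>a2. Gamma (x + t)) * (\<Prod>x\<leftarrow>b1. Gamma (1 - x - t)) *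
     (\<Prod>x\<leftarrow>a1. rGamma (1 - x - t)) * (\<Prod>x\<leftarrow>b2. rGamma (x + t)))"
  define w where "w = (of_nat k :: complex)"
  have n: "x \<in> set a2 \<Longrightarrow> x + w \<notin> \<int>\<^sub>\<le>\<^sub>0" "x \<in> set b1 \<Longrightarrow> 1 - x - w \<notin> \<int>\<^sub>\<le>\<^sub>0"
     "x \<in> set a1 \<Longrightarrow> 1 - x - w \<notin> \<int>\<^sub>\<le>\<^sub>0" "x \<in> set b2 \<Longrightarrow> x + w \<notin> \<int>\<^sub>\<le>\<^sub>0"
     "1 + w \<notin> \<int>\<^sub>\<le>\<^sub>0" for x
  proof -
    show "x + w \<notin> \<int>\<^sub>\<le>\<^sub>0" if "x \<in> set a2"
      using a2_nonint that unfolding w_def by (intro notin_nonpos_IntsI) (simp add: Ints_shift)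
    show "x + w \<notin> \<int>\<^sub>\<le>\<^sub>0" if "x \<in> set b2"
      using b2_gen that unfolding w_def by (intro add_of_nat_notin_nonpos_Ints) simp
    show "1 - x - w \<notin> \<int>\<^sub>\<le>\<^sub>0" if "x \<in> set b1"
      using b1_nonint that unfolding w_def by (intro notin_nonpos_IntsI) (simp add: Ints_shift)
    show "1 - x - w \<notin> \<int>\<^sub>\<le>\<^sub>0" if "x \<in> set a1"
      using a1_nonint that unfolding w_def by (intro notin_nonpos_IntsI) (simp add: Ints_shift)
    show "1 + w \<notin> \<int>\<^sub>\<le>\<^sub>0"
      unfolding w_def by (intro add_of_nat_notin_nonpos_Ints) simp
  qed
  have "G = (\<lambda>t. h t * (Gamma (-t) ^ 2 * Gamma (1 + t)))"
    by (simp add: h_def barnes_integrand_def fun_eq_iff)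
  hence "residue G w = residue (\<lambda>t. h t * (Gamma (-t) ^ 2 * Gamma (1 + t))) w" by simp
  also have "\<dots> = deriv (\<lambda>t. h t * rGamma (1 + t)) w"
    unfolding w_def
  proof (rule residue_Gamma_double_pole)
    show "h analytic_on {of_nat k}"
      unfolding h_def using n unfolding w_def by (intro analytic_intros) auto
  qed
  also have "\<dots> = h w * rGamma (1 + w) * ((\<Sum>x\<leftarrow>a2. Digamma (x + w)) + (\<Sum>x\<leftarrow>b1. - Digamma (1 - x - w))
      + (\<Sum>x\<leftarrow>a1. Digamma (1 - x - w)) + (\<Sum>x\<leftarrow>b2. - Digamma (x + w)) - Digamma (1 + w))"
  proof (rule DERIV_imp_deriv)
    have A2: "((\<lambda>t. \<Prod>x\<leftarrow>a2. Gamma (x + t)) has_field_derivative 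
         (\<Prod>x\<leftarrow>a2. Gamma (x + w)) * (\<Sum>x\<leftarrow>a2. Digamma (x + w))) (at w)"
      by (rule DERIV_prod_list_log) (auto intro!: derivative_eq_intros n(1))
    have B1: "((\<lambda>t. \<Prod>x\<leftarrow>b1. Gamma (1 - x - t)) has_field_derivative 
         (\<Prod>x\<leftarrow>b1. Gamma (1 - x - w)) * (\<Sum>x\<leftarrow>b1. - Digamma (1 - x - w))) (at w)"
      by (rule DERIV_prod_list_log) (auto intro!: derivative_eq_intros n(2))
    have A1: "((\<lambda>t. \<Prod>x\<leftarrow>a1. rGamma (1 - x - t)) has_field_derivative 
         (\<Prod>x\<leftarrow>a1. rGamma (1 - x - w)) * (\<Sum>x\<leftarrow>a1. Digamma (1 - x - w))) (at w)"
    proof (rule DERIV_prod_list_log)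
      fix x assume x: "x \<in> set a1"
      have "((\<lambda>t. rGamma (1 - x - t)) has_field_derivative (- rGamma (1 - x - w) * Digamma (1 - x - w)) * (- 1)) (at w)"
        by (rule DERIV_chain2[where f = rGamma], rule has_field_derivative_rGamma_no_nonpos_int[OF n(3)[OF x]])
           (auto intro!: derivative_eq_intros)
      thus "((\<lambda>t. rGamma (1 - x - t)) has_field_derivative rGamma (1 - x - w) * Digamma (1 - x - w)) (at w)" by simp
    qed
    have B2: "((\<lambda>t. \<Prod>x\<leftarrow>b2. rGamma (x + t)) has_field_derivative 
         (\<Prod>x\<leftarrow>b2. rGamma (x + w)) * (\<Sum>x\<leftarrow>b2. - Digamma (x + w))) (at w)"
    proof (rule DERIV_prod_list_log)
      fix x assume x: "x \<in> set b2"
      have "((\<lambda>t. rGamma (x + t)) has_field_derivative (- rGamma (x + w) * Digamma (x + w)) * 1) (at w)"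
        by (rule DERIV_chain2[where f = rGamma], rule has_field_derivative_rGamma_no_nonpos_int[OF n(4)[OF x]])
           (auto intro!: derivative_eq_intros)
      thus "((\<lambda>t. rGamma (x + t)) has_field_derivative rGamma (x + w) * - Digamma (x + w)) (at w)" by simp
    qed
    have C: "((\<lambda>t. rGamma (1 + t)) has_field_derivative (- rGamma (1 + w) * Digamma (1 + w)) * 1) (at w)"
        by (rule DERIV_chain2[where f = rGamma], rule has_field_derivative_rGamma_no_nonpos_int[OF n(5)])
           (auto intro!: derivative_eq_intros)
    note d = DERIV_mult'[OF DERIV_mult'[OF DERIV_mult'[OF DERIV_mult'[OF A2 B1] A1] B2] C]
    show "((\<lambda>t. h t * rGamma (1 + t)) has_field_derivative
      h w * rGamma (1 + w) * ((\<Sum>x\<leftarrow>a2. Digamma (x + w)) + (\<Sum>x\<leftarrow>b1. - Digamma (1 - x - w))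
      + (\<Sum>x\<leftarrow>a1. Digamma (1 - x - w)) + (\<Sum>x\<leftarrow>b2. - Digamma (x + w)) - Digamma (1 + w))) (at w)"
      unfolding h_def by (rule DERIV_cong[OF d]) (simp only: ring_distribs, simp add: mult_ac add_ac)
  qed
  also have "h w * rGamma (1 + w) = D * (pochL a k / pochL b k * z ^ k / of_nat (fact k))"
  proof -
    have 1: "(\<Prod>x\<leftarrow>a2. Gamma (x + w)) = GammaL a2 * pochL a2 k"
      using a2_nonint notin_nonpos_IntsI unfolding w_def 
      by (subst prod_list_Gamma_add_of_nat[where f = "\<lambda>x. x"]) auto
    have 2: "(\<Prod>x\<leftarrow>b1. Gamma (1 - x - w)) = ((-1) ^ k) ^ length b1 * GammaL (map (\<lambda>x. 1 - x) b1) / pochL b1 k"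
      unfolding w_def by (subst prod_list_Gamma_diff_of_nat[where f = "\<lambda>x. 1 - x"]) simp
    have 3: "(\<Prod>x\<leftarrow>a1. rGamma (1 - x - w)) = ((-1) ^ k) ^ length a1 * pochL a1 k / GammaL (map (\<lambda>x. 1 - x) a1)"
      unfolding w_def by (subst prod_list_rGamma_diff_of_nat[where f = "\<lambda>x. 1 - x"]) simp
    have 4: "(\<Prod>x\<leftarrow>b2. rGamma (x + w)) = 1 / (GammaL b2 * pochL b2 k)"
      using b2_gen unfolding w_def 
      by (subst prod_list_rGamma_add_of_nat[where f = "\<lambda>x. x"]) auto
    have 5: "rGamma (1 + w) = 1 / of_nat (fact k)"
      unfolding w_def by (simp add: rGamma_inverse_Gamma Gamma_fact divide_inverse)
    show ?thesis unfolding h_def 1 2 3 4 5 D_def z_power by (simp add: divide_inverse mult_ac)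
  qed
  \<comment> \<open>After reflection the cotangent is taken at x + k; it loses k by periodicity, and
    therefore factors out of the whole series.\<close>
  also have "(\<Sum>x\<leftarrow>b1. - Digamma (1 - x - w)) = - (\<Sum>x\<leftarrow>b1. Digamma (x + w)) - of_real pi * (\<Sum>x\<leftarrow>b1. cot (of_real pi * x))"
    using b1_nonint
  proof (induction b1)
    case (Cons x xs)
    hence "Digamma (1 - x - w) = Digamma (x + w) + of_real pi * cot (of_real pi * x)"
      using Digamma_reflection_complex[of "x + w"] by (simp add: w_def Ints_shift cot_pi_add_of_nat diff_diff_eq)
    thus ?case using Cons by (simp add: algebra_simps)
  qed auto
  also have "(\<Sum>x\<leftarrow>a1. Digamma (1 - x - w)) = (\<Sum>x\<leftarrow>a1. Digamma (x + w)) + of_real pi * (\<Sum>x\<leftarrow>a1. cot (of_real pi * x))"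
    using a1_nonint
  proof (induction a1)
    case (Cons x xs)
    hence "Digamma (1 - x - w) = Digamma (x + w) + of_real pi * cot (of_real pi * x)"
      using Digamma_reflection_complex[of "x + w"] by (simp add: w_def Ints_shift cot_pi_add_of_nat diff_diff_eq)
    thus ?case using Cons by (simp add: algebra_simps)
  qed auto
  also have "(\<Sum>x\<leftarrow>b2. - Digamma (x + w)) = - (\<Sum>x\<leftarrow>b2. Digamma (x + w))"
    by (induction b2) auto
  finally show ?thesis unfolding w_def by (simp add: algebra_simps)
qed

text \<open>At t = -1 - k only Gamma(1 + t) is singular, with residue (-1)^k / k!. The two upper
  parameters 1 come from Gamma(-t)^2 = (k!)^2.\<close>

lemma residue_negative:
  "residue G (- 1 - of_nat k) = - (D * (z * pochL (map (\<lambda>x. 1 - x) b) 1 / pochL (map (\<lambda>x. 1 - x) a) 1)) *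
     (pochL ([1, 1] @ map (\<lambda>x. 2 - x) b) k / pochL (map (\<lambda>x. 2 - x) a) k * z ^ k / of_nat (fact k))"
proof -
  define h where "h = (\<lambda>t. (\<Prod>x\<leftarrow>a2. Gamma (x + t)) * (\<Prod>x\<leftarrow>b1. Gamma (1 - x - t)) *
     (\<Prod>x\<leftarrow>a1. rGamma (1 - x - t)) * (\<Prod>x\<leftarrow>b2. rGamma (x + t)) * Gamma (-t) ^ 2)"
  define w where "w = - (of_nat (Suc k) :: complex)"
  have w: "w = - 1 - of_nat k" by (simp add: w_def)
  have n: "\<And>x. x \<in> set a2 \<Longrightarrow> x + w \<notin> \<int>\<^sub>\<le>\<^sub>0" "\<And>x. x \<in> set b1 \<Longrightarrow> 1 - x - w \<notin> \<int>\<^sub>\<le>\<^sub>0" "- w \<notin> \<int>\<^sub>\<le>\<^sub>0"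
  proof -
    show "x + w \<notin> \<int>\<^sub>\<le>\<^sub>0" if "x \<in> set a2" for x
      using a2_nonint that Ints_shift(4)[of x "Suc k"] by (intro notin_nonpos_IntsI) (simp add: w_def)
    show "1 - x - w \<notin> \<int>\<^sub>\<le>\<^sub>0" if "x \<in> set b1" for x
      using b1_nonint that Ints_shift(2)[of "1 - x" "Suc k"] 
      by (intro notin_nonpos_IntsI) (simp add: w_def Ints_shift)
    show "- w \<notin> \<int>\<^sub>\<le>\<^sub>0"
      using add_of_nat_notin_nonpos_Ints[of 1 k] by (simp add: w_def add.commute)
  qed
  have "G = (\<lambda>t. Gamma (1 + 1 * t) * h t)"
    by (simp add: h_def barnes_integrand_def mult_ac fun_eq_iff)
  hence "residue G w = residue (\<lambda>t. Gamma (1 + 1 * t) * h t) w" by simp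
  also have "\<dots> = (-1) ^ k / fact k * h w"
  proof (subst residue_Gamma_mult[where k = k])
    show "h analytic_on {w}"
      unfolding h_def using n by (intro analytic_intros) auto
  qed (auto simp: w_def)
  also have "h w = D * ((-1) ^ Suc k * z ^ Suc k) * pochL (map (\<lambda>x. 1 - x) b) (Suc k) / pochL (map (\<lambda>x. 1 - x) a) (Suc k) * fact k ^ 2"
  proof -
    have e: "x + w = x - of_nat (Suc k)" "1 - x - w = 1 - x + of_nat (Suc k)" for x
      by (simp_all add: w_def)
    have 1: "(\<Prod>x\<leftarrow>a2. Gamma (x + w)) = ((-1) ^ Suc k) ^ length a2 * GammaL a2 / pochL (map (\<lambda>x. 1 - x) a2) (Suc k)"
      unfolding e by (subst prod_list_Gamma_diff_of_nat) simp
    have 2: "(\<Prod>x\<leftarrow>b1. Gamma (1 - x - w)) = GammaL (map (\<lambda>x. 1 - x) b1) * pochL (map (\<lambda>x. 1 - x) b1) (Suc k)"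
      unfolding e using b1_nonint by (subst prod_list_Gamma_add_of_nat) (auto intro!: notin_nonpos_IntsI simp: Ints_shift)
    have 3: "(\<Prod>x\<leftarrow>a1. rGamma (1 - x - w)) = 1 / (GammaL (map (\<lambda>x. 1 - x) a1) * pochL (map (\<lambda>x. 1 - x) a1) (Suc k))"
      unfolding e using a1_nonint by (subst prod_list_rGamma_add_of_nat) (auto intro!: notin_nonpos_IntsI simp: Ints_shift)
    have 4: "(\<Prod>x\<leftarrow>b2. rGamma (x + w)) = ((-1) ^ Suc k) ^ length b2 * pochL (map (\<lambda>x. 1 - x) b2) (Suc k) / GammaL b2"
      unfolding e by (subst prod_list_rGamma_diff_of_nat) simp
    have 5: "Gamma (- w) = fact k"
      using Gamma_fact[of k, where 'a = complex] by (simp add: w_def add.commute)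
    show ?thesis unfolding h_def 1 2 3 4 5 D_def neg_one_power_length[of "Suc k", symmetric]
      by (simp add: divide_inverse mult_ac)
  qed
  also have "(-1) ^ k / fact k * (D * ((-1) ^ Suc k * z ^ Suc k) * pochL (map (\<lambda>x. 1 - x) b) (Suc k) / pochL (map (\<lambda>x. 1 - x) a) (Suc k) * fact k ^ 2)
    = - (D * (z * z ^ k) * pochL (map (\<lambda>x. 1 - x) b) (Suc k) / pochL (map (\<lambda>x. 1 - x) a) (Suc k)) * (fact k * fact k / fact k)"
    by (simp add: power2_eq_square flip: power_mult_distrib)
  also have "pochL (map (\<lambda>x. 1 - x) b) (Suc k) = pochL (map (\<lambda>x. 1 - x) b) 1 * pochL (map (\<lambda>x. 2 - x) b) k"
    by (subst pochL_Suc) (simp add: algebra_simps)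
  also have "pochL (map (\<lambda>x. 1 - x) a) (Suc k) = pochL (map (\<lambda>x. 1 - x) a) 1 * pochL (map (\<lambda>x. 2 - x) a) k"
    by (subst pochL_Suc) (simp add: algebra_simps)
  finally show ?thesis 
    unfolding w by (simp add: divide_inverse mult_ac flip: pochhammer_fact power_mult_distrib)
qed

text \<open>Up to the factor pi, this and \<open>coeff_b\<close> are the residues of the integrand
  at the first pole (k = 0) of the respective family.\<close>

definition coeff_a :: "nat \<Rightarrow> complex" where
  "coeff_a i = (let ak = a2 ! i in
              Gamma ak * GammaL (map (\<lambda>x. x - ak) (del_nth i a2))
                * GammaL (map (\<lambda>x. 1 - x + ak) b1)
              / (sin (complex_of_real pi * ak) * GammaL (map (\<lambda>x. x - ak) b2)
                 * GammaL (map (\<lambda>x. 1 - x + ak) a1)))"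

definition coeff_b :: "nat \<Rightarrow> complex" where
  "coeff_b i = (let bk = b1 ! i in
              Gamma (bk - 1) * GammaL (map (\<lambda>x. bk - x) (del_nth i b1))
                * GammaL (map (\<lambda>x. 1 - bk + x) a2)
              / (sin (complex_of_real pi * bk) * GammaL (map (\<lambda>x. bk - x) a1)
                 * GammaL (map (\<lambda>x. 1 - bk + x) b2)))"

text \<open>Here e stands for (-1)^k: the sign in the residue of Gamma meets the sign left over by
  the other factors, and e e = 1.\<close>

lemma sign_rearrange:
  "e / F * (A * (e * Z) * (P / Q)) = (e * e) * (A * (P / Q * Z / F))"
  "(- 1) * e / F * - (A * (e * Z) * (P / Q)) = (e * e) * (A * (P / Q * Z / F))" for e :: complex
  by (simp_all add: divide_inverse mult_ac)

text \<open>The pole belongs to the single factor Gamma(a_k + t); incongruence within a2 and the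
  remaining genericity keep all other factors analytic there.\<close>

lemma residue_a:
  assumes i: "i < length a2"
  defines "ak \<equiv> a2 ! i"
  shows "residue G (- ak - of_nat k) = of_real pi * coeff_a i *
     (pochL (ak # map (\<lambda>x. 1 - x + ak) b) k / pochL (map (\<lambda>x. 1 - x + ak) (a1 @ del_nth i a2)) k * z ^ k / of_nat (fact k))"
proof -
  define h where "h = (\<lambda>t. (\<Prod>x\<leftarrow>del_nth i a2. Gamma (x + t)) * (\<Prod>x\<leftarrow>b1. Gamma (1 - x - t)) *
     (\<Prod>x\<leftarrow>a1. rGamma (1 - x - t)) * (\<Prod>x\<leftarrow>b2. rGamma (x + t)) * (Gamma (-t) ^ 2 * Gamma (1 + t)))"
  define w where "w = - ak - of_nat k"
  have ak: "ak \<notin> \<int>" "ak \<in> set a2" using a2_nonint i by (auto simp: ak_def)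
  have n1: "x + w \<notin> \<int>\<^sub>\<le>\<^sub>0" if x: "x \<in> set (del_nth i a2)" for x
  proof -
    from x obtain j where "j < length a2" "j \<noteq> i" "x = a2 ! j" by (rule in_set_del_nth)
    hence "x - ak \<notin> \<int>" using a2_distinct i by (auto simp: ak_def)
    hence "x - ak - of_nat k \<notin> \<int>" by (simp add: Ints_shift)
    thus ?thesis by (intro notin_nonpos_IntsI) (simp add: w_def algebra_simps)
  qed
  have n2: "1 - x - w \<notin> \<int>\<^sub>\<le>\<^sub>0" if x: "x \<in> set b1" for x
  proof -
    have "1 - x + ak + of_nat k \<notin> \<int>\<^sub>\<le>\<^sub>0"
      using a2k_gen x i by (intro add_of_nat_notin_nonpos_Ints) (auto simp: ak_def)
    thus ?thesis by (simp add: w_def algebra_simps)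
  qed
  have n3: "- w \<notin> \<int>\<^sub>\<le>\<^sub>0" "1 + w \<notin> \<int>\<^sub>\<le>\<^sub>0"
    using ak Ints_shift(1)[of ak k] Ints_shift(2)[of ak k] by (auto simp: w_def intro!: notin_nonpos_IntsI)
  have "G = (\<lambda>t. Gamma (ak + 1 * t) * h t)"
    using prod_list_del_nth[OF i] by (simp add: h_def barnes_integrand_def ak_def mult_ac fun_eq_iff)
  hence "residue G w = residue (\<lambda>t. Gamma (ak + 1 * t) * h t) w" by simp
  also have "\<dots> = (-1) ^ k / fact k * h w"
  proof (subst residue_Gamma_mult[where k = k])
    show "h analytic_on {w}"
      unfolding h_def using n1 n2 n3 by (intro analytic_intros) auto
  qed (auto simp: w_def)
  also have "h w = of_real pi * coeff_a i * ((-1) ^ k * z ^ k) *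
      (pochL (ak # map (\<lambda>x. 1 - x + ak) b) k / pochL (map (\<lambda>x. 1 - x + ak) (a1 @ del_nth i a2)) k)"
  proof -
    have e: "x + w = x - ak - of_nat k" "1 - x - w = 1 - x + ak + of_nat k" for x
      by (simp_all add: w_def)
    have e': "1 - (x - ak) = 1 - x + ak" for x by simp
    have 1: "(\<Prod>x\<leftarrow>del_nth i a2. Gamma (x + w)) = ((-1) ^ k) ^ length (del_nth i a2) * GammaL (map (\<lambda>x. x - ak) (del_nth i a2))
         / pochL (map (\<lambda>x. 1 - x + ak) (del_nth i a2)) k"
      unfolding e by (subst prod_list_Gamma_diff_of_nat) (simp only: e')
    have 2: "(\<Prod>x\<leftarrow>b1. Gamma (1 - x - w)) = GammaL (map (\<lambda>x. 1 - x + ak) b1) * pochL (map (\<lambda>x. 1 - x + ak) b1) k"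
      unfolding e using a2k_gen i by (subst prod_list_Gamma_add_of_nat) (auto simp: ak_def)
    have 3: "(\<Prod>x\<leftarrow>a1. rGamma (1 - x - w)) = 1 / (GammaL (map (\<lambda>x. 1 - x + ak) a1) * pochL (map (\<lambda>x. 1 - x + ak) a1) k)"
      unfolding e using a2k_gen i by (subst prod_list_rGamma_add_of_nat) (auto simp: ak_def)
    have 4: "(\<Prod>x\<leftarrow>b2. rGamma (x + w)) = ((-1) ^ k) ^ length b2 * pochL (map (\<lambda>x. 1 - x + ak) b2) k / GammaL (map (\<lambda>x. x - ak) b2)"
      unfolding e by (subst prod_list_rGamma_diff_of_nat) (simp only: e')
    \<comment> \<open>One Gamma(-w) is reflected against Gamma(1 + w), which puts the sine of pi
      \<open>ak\<close> into the denominator. The other one is Gamma(\<open>ak\<close> + k), which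
      yields the upper parameter \<open>ak\<close>.\<close>
    have 5: "Gamma (- w) ^ 2 * Gamma (1 + w) = (-1) ^ k * of_real pi * Gamma ak * pochhammer ak k / sin (of_real pi * ak)"
    proof -
      have "Gamma (- w) * Gamma (1 + w) = of_real pi / sin (of_real pi * (- w))"
        using Gamma_reflection_complex[of "- w"] by simp
      also have "sin (of_real pi * (- w)) = sin (of_real pi * (ak + of_nat k))"
        by (simp add: w_def add.commute)
      finally have "Gamma (- w) * Gamma (1 + w) = of_real pi / sin (of_real pi * (ak + of_nat k))" .
      moreover have "Gamma (- w) = Gamma ak * pochhammer ak k"
        using Gamma_add_of_nat[of ak k] ak notin_nonpos_IntsI by (simp add: w_def add.commute)
      ultimately have "Gamma (- w) * (Gamma (- w) * Gamma (1 + w)) = Gamma ak * pochhammer ak k * (of_real pi / ((-1) ^ k * sin (of_real pi * ak)))"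
        by (simp only: sin_pi_add_of_nat)
      thus ?thesis by (simp add: power2_eq_square divide_inverse mult_ac flip: power_inverse)
    qed
    \<comment> \<open>The sign from shifting the sine replaces the one lost by removing
      \<open>ak\<close> from a2.\<close>
    have "((-1) ^ k) ^ length (del_nth i a2) * ((-1) ^ k) ^ length b2 * (-1) ^ k = 
        (((-1) ^ k) ^ length a2 * ((-1) ^ k) ^ length b2 :: complex)"
      unfolding length_del_nth[OF i, symmetric] by (simp add: mult_ac)
    also have "\<dots> = (-1) ^ k * z ^ k" by (rule neg_one_power_length)
    finally show ?thesis unfolding h_def 1 2 3 4 5 coeff_a_def Let_def ak_def[symmetric] 
      by (simp only: pochL_simps GammaL_simps map_append divide_inverse inverse_mult_distrib) 
         (simp add: mult_ac)
  qed
  finally show ?thesis unfolding sign_rearrange w_def by (simp flip: power_mult_distrib)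
qed

text \<open>The poles of Gamma(1 - b_k - t) run to the right, so the residue carries a factor -1. It
  cancels the minus sign that arises from shifting the sine by k + 1 instead of k.\<close>

lemma residue_b:
  assumes i: "i < length b1"
  defines "bk \<equiv> b1 ! i"
  shows "residue G (1 - bk + of_nat k) = of_real pi * coeff_b i *
     (pochL (map (\<lambda>x. 1 - bk + x) a) k / pochL ((2 - bk) # map (\<lambda>x. 1 - bk + x) (del_nth i b1 @ b2)) k * z ^ k / of_nat (fact k))"
proof -
  define h where "h = (\<lambda>t. (\<Prod>x\<leftarrow>a2. Gamma (x + t)) * (\<Prod>x\<leftarrow>del_nth i b1. Gamma (1 - x - t)) *
     (\<Prod>x\<leftarrow>a1. rGamma (1 - x - t)) * (\<Prod>x\<leftarrow>b2. rGamma (x + t)) * (Gamma (-t) ^ 2 * Gamma (1 + t)))"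
  define w where "w = 1 - bk + of_nat k"
  have bk: "bk \<notin> \<int>" using b1_nonint i by (auto simp: bk_def)
  have n1: "1 - x - w \<notin> \<int>\<^sub>\<le>\<^sub>0" if x: "x \<in> set (del_nth i b1)" for x
  proof -
    from x obtain j where "j < length b1" "j \<noteq> i" "x = b1 ! j" by (rule in_set_del_nth)
    hence "bk - x \<notin> \<int>" using b1_distinct i by (auto simp: bk_def)
    hence "bk - x - of_nat k \<notin> \<int>" by (simp add: Ints_shift)
    thus ?thesis by (intro notin_nonpos_IntsI) (simp add: w_def algebra_simps)
  qed
  have n2: "x + w \<notin> \<int>\<^sub>\<le>\<^sub>0" if x: "x \<in> set a2" for x
  proof -
    have "1 - bk + x + of_nat k \<notin> \<int>\<^sub>\<le>\<^sub>0"
      using b1k_gen x i by (intro add_of_nat_notin_nonpos_Ints) (auto simp: bk_def)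
    thus ?thesis by (simp add: w_def algebra_simps)
  qed
  have n3: "- w \<notin> \<int>\<^sub>\<le>\<^sub>0" "1 + w \<notin> \<int>\<^sub>\<le>\<^sub>0"
  proof -
    have "bk - 1 - of_nat k \<notin> \<int>" using bk Ints_shift(5)[of bk k] by simp
    thus "- w \<notin> \<int>\<^sub>\<le>\<^sub>0" by (intro notin_nonpos_IntsI) (simp add: w_def algebra_simps)
    have "2 - bk + of_nat k \<notin> \<int>" using bk Ints_shift(6)[of bk k] by simp
    thus "1 + w \<notin> \<int>\<^sub>\<le>\<^sub>0" by (intro notin_nonpos_IntsI) (simp add: w_def algebra_simps)
  qed
  have "G = (\<lambda>t. Gamma ((1 - bk) + (- 1) * t) * h t)"
    using prod_list_del_nth[OF i] by (simp add: h_def barnes_integrand_def bk_def mult_ac fun_eq_iff)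
  hence "residue G w = residue (\<lambda>t. Gamma ((1 - bk) + (- 1) * t) * h t) w" by simp
  also have "\<dots> = (- 1) * (-1) ^ k / fact k * h w"
  proof (subst residue_Gamma_mult[where k = k])
    show "h analytic_on {w}"
      unfolding h_def using n1 n2 n3 by (intro analytic_intros) auto
  qed (auto simp: w_def)
  also have "h w = - (of_real pi * coeff_b i * ((-1) ^ k * z ^ k) *
      (pochL (map (\<lambda>x. 1 - bk + x) a) k / pochL ((2 - bk) # map (\<lambda>x. 1 - bk + x) (del_nth i b1 @ b2)) k))"
  proof -
    have e: "x + w = 1 - bk + x + of_nat k" "1 - x - w = bk - x - of_nat k" for x
      by (simp_all add: w_def)
    have e': "1 - (bk - x) = 1 - bk + x" for x by simp
    have 1: "(\<Prod>x\<leftarrow>del_nth i b1. Gamma (1 - x - w)) = ((-1) ^ k) ^ length (del_nth i b1) * GammaL (map (\<lambda>x. bk - x) (del_nth i b1))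
         / pochL (map (\<lambda>x. 1 - bk + x) (del_nth i b1)) k"
      unfolding e by (subst prod_list_Gamma_diff_of_nat) (simp only: e')
    have 2: "(\<Prod>x\<leftarrow>a2. Gamma (x + w)) = GammaL (map (\<lambda>x. 1 - bk + x) a2) * pochL (map (\<lambda>x. 1 - bk + x) a2) k"
      unfolding e using b1k_gen i by (subst prod_list_Gamma_add_of_nat) (auto simp: bk_def)
    have 3: "(\<Prod>x\<leftarrow>b2. rGamma (x + w)) = 1 / (GammaL (map (\<lambda>x. 1 - bk + x) b2) * pochL (map (\<lambda>x. 1 - bk + x) b2) k)"
      unfolding e using b1k_gen i by (subst prod_list_rGamma_add_of_nat) (auto simp: bk_def)
    have 4: "(\<Prod>x\<leftarrow>a1. rGamma (1 - x - w)) = ((-1) ^ k) ^ length a1 * pochL (map (\<lambda>x. 1 - bk + x) a1) k / GammaL (map (\<lambda>x. bk - x) a1)"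
      unfolding e by (subst prod_list_rGamma_diff_of_nat) (simp only: e')
    \<comment> \<open>As before one Gamma(-w) goes into the sine. The other one is
      Gamma(\<open>bk\<close> - 1 - k), which yields Gamma(\<open>bk\<close> - 1) and the lower
      parameter 2 - \<open>bk\<close>.\<close>
    have 5: "Gamma (- w) ^ 2 * Gamma (1 + w) = - (of_real pi * Gamma (bk - 1) / (sin (of_real pi * bk) * pochhammer (2 - bk) k))"
    proof -
      have "Gamma (- w) * Gamma (1 + w) = of_real pi / sin (of_real pi * (- w))"
        using Gamma_reflection_complex[of "- w"] by simp
      also have "sin (of_real pi * bk) = (-1) ^ Suc k * sin (of_real pi * (- w))"
        using sin_pi_add_of_nat[of "- w" "Suc k"] by (simp add: w_def)
      hence "sin (of_real pi * (- w)) = (-1) ^ Suc k * sin (of_real pi * bk)"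
        by (simp flip: power_mult_distrib)
      finally have "Gamma (- w) * Gamma (1 + w) = of_real pi / ((-1) ^ Suc k * sin (of_real pi * bk))" .
      moreover have "Gamma (- w) = (-1) ^ k * Gamma (bk - 1) / pochhammer (2 - bk) k"
        using Gamma_diff_of_nat[of "bk - 1" k] by (simp add: w_def algebra_simps)
      ultimately have "Gamma (- w) * (Gamma (- w) * Gamma (1 + w)) = 
          (-1) ^ k * Gamma (bk - 1) / pochhammer (2 - bk) k * (of_real pi / ((-1) ^ Suc k * sin (of_real pi * bk)))"
        by simp
      thus ?thesis by (simp add: power2_eq_square field_simps)
    qed
    \<comment> \<open>Removing one entry of b1 from the sign count of z^k leaves the extra
      (-1)^k.\<close>
    have len: "((-1) ^ k) ^ length (del_nth i b1) * ((-1) ^ k) ^ length a1 = (-1) ^ k * z ^ k"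
      unfolding z_power length_del_nth[OF i, symmetric] by (simp add: mult_ac flip: power_mult_distrib)
    show ?thesis unfolding h_def 1 2 3 4 5 coeff_b_def Let_def bk_def[symmetric] len[symmetric]
      by (simp only: pochL_simps GammaL_simps map_append list.map divide_inverse inverse_mult_distrib) 
         (simp add: mult_ac)
  qed
  also have "(- 1) * (-1) ^ k / fact k * - (of_real pi * coeff_b i * ((-1) ^ k * z ^ k) *
      (pochL (map (\<lambda>x. 1 - bk + x) a) k / pochL ((2 - bk) # map (\<lambda>x. 1 - bk + x) (del_nth i b1 @ b2)) k))
    = ((-1) ^ k * (-1) ^ k) * (of_real pi * coeff_b i *
     (pochL (map (\<lambda>x. 1 - bk + x) a) k / pochL ((2 - bk) # map (\<lambda>x. 1 - bk + x) (del_nth i b1 @ b2)) k * z ^ k / of_nat (fact k)))"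
    by (simp only: sign_rearrange of_nat_fact)
  finally show ?thesis unfolding w_def by (simp flip: power_mult_distrib)
qed

end

section \<open>The poles of the integrand as one indexed system of arithmetic progressions\<close>

datatype pole_family = Nonneg | Negative | From_a nat | From_b nat

context barnes_data
begin

definition center :: "pole_family \<Rightarrow> complex" where
  "center j = (case j of Nonneg \<Rightarrow> 0 | Negative \<Rightarrow> - 1 | From_a i \<Rightarrow> - (a2 ! i) | From_b i \<Rightarrow> 1 - b1 ! i)"

definition direction :: "pole_family \<Rightarrow> complex" where
  "direction j = (case j of Nonneg \<Rightarrow> 1 | Negative \<Rightarrow> - 1 | From_a i \<Rightarrow> - 1 | From_b i \<Rightarrow> 1)"

definition families :: "pole_family set" where
  "families = {Nonneg, Negative} \<union> From_a ` {..<length a2} \<union> From_b ` {..<length b1}"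

definition pole :: "pole_family \<times> nat \<Rightarrow> complex" where
  "pole = (\<lambda>(j, k). center j + direction j * of_nat k)"

lemmas pole_simps = pole_def center_def direction_def

text \<open>The first two families consist of integers and the others of non-integers; within a2 or
  b1 incongruence modulo 1 separates the poles. A pole shared by the families of a_i and b_j would
  make 1 - b_j + a_i a non-positive integer, against \<open>a2k_gen\<close>.\<close>

lemma inj_on_pole: "inj_on pole (families \<times> UNIV)"
proof -
  have ne: "pole (Nonneg, k) \<noteq> pole (Negative, l)" for k l
  proof
    assume "pole (Nonneg, k) = pole (Negative, l)"
    hence "of_nat (k + l + 1) = (0 :: complex)" by (simp add: pole_simps algebra_simps)
    thus False by (subst (asm) of_nat_eq_0_iff) simp
  qed
  have Ints: "pole (Nonneg, k) \<in> \<int>" "pole (Negative, k) \<in> \<int>" for k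
    by (simp_all add: pole_simps)
  have nInts: "i < length a2 \<Longrightarrow> pole (From_a i, k) \<notin> \<int>" "i < length b1 \<Longrightarrow> pole (From_b i, k) \<notin> \<int>" for i k
  proof -
    assume "i < length a2"
    thus "pole (From_a i, k) \<notin> \<int>"
      using a2_nonint Ints_shift(2)[of "a2 ! i" k] minus_in_Ints_iff[of "a2 ! i + of_nat k"] by (simp add: pole_simps)
  next
    assume "i < length b1"
    thus "pole (From_b i, k) \<notin> \<int>"
      using b1_nonint by (simp add: pole_simps Ints_shift)
  qed
  have aa: "i = j \<and> k = l" if "i < length a2" "j < length a2" "pole (From_a i, k) = pole (From_a j, l)" for i j k l
  proof -
    have eq: "a2 ! i - a2 ! j = of_int (int l - int k)"
      using that(3) by (simp add: pole_simps algebra_simps)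
    hence "i = j" using a2_distinct that(1,2) by (metis Ints_of_int)
    thus ?thesis using that(3) by (simp add: pole_simps)
  qed
  have bb: "i = j \<and> k = l" if "i < length b1" "j < length b1" "pole (From_b i, k) = pole (From_b j, l)" for i j k l
  proof -
    have eq: "b1 ! i - b1 ! j = of_int (int k - int l)"
      using that(3) by (simp add: pole_simps algebra_simps)
    hence "i = j" using b1_distinct that(1,2) by (metis Ints_of_int)
    thus ?thesis using that(3) by (simp add: pole_simps)
  qed
  have ab: "pole (From_a i, k) \<noteq> pole (From_b j, l)" if "i < length a2" "j < length b1" for i j k l
  proof
    assume "pole (From_a i, k) = pole (From_b j, l)"
    hence "1 - b1 ! j + a2 ! i = - of_nat (k + l)"
      by (simp add: pole_simps algebra_simps)
    hence "1 - b1 ! j + a2 ! i \<in> \<int>\<^sub>\<le>\<^sub>0" by (metis minus_of_nat_in_nonpos_Ints)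
    thus False using a2k_gen that by (meson nth_mem)
  qed
  have N: "k = l" if "pole (Nonneg, k) = pole (Nonneg, l) \<or> pole (Negative, k) = pole (Negative, l)" for k l
    using that by (auto simp: pole_simps)
  have "j = j' \<and> k = k'" if "j \<in> families" "j' \<in> families" "pole (j, k) = pole (j', k')" for j j' k k'
    using that ne[of k k'] ne[of k' k] Ints nInts aa ab bb N
    by (cases j; cases j') (auto simp: families_def, metis+)
  thus ?thesis by (auto intro!: inj_onI)
qed

text \<open>A Gamma factor is singular only where its argument is a non-positive integer, and each
  such point belongs to the family named after that factor.\<close>

lemma holomorphic_G: "G holomorphic_on - pole ` (families \<times> UNIV)"
proof -
  define P where "P = pole ` (families \<times> UNIV)"
  have mem: "pole (j, k) \<in> P" if "j \<in> families" for j k using that by (auto simp: P_def)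
  have 1: "x + t \<notin> \<int>\<^sub>\<le>\<^sub>0" if "x \<in> set a2" "t \<notin> P" for x t
  proof
    assume "x + t \<in> \<int>\<^sub>\<le>\<^sub>0"
    then obtain k :: nat where k: "x + t = - of_nat k" by (elim nonpos_Ints_cases')
    obtain i where i: "i < length a2" "x = a2 ! i" using \<open>x \<in> set a2\<close> by (auto simp: in_set_conv_nth)
    have "t = pole (From_a i, k)" using k i by (simp add: pole_simps algebra_simps eq_neg_iff_add_eq_0)
    thus False using that mem[of "From_a i" k] i by (auto simp: families_def)
  qed
  have 2: "1 - x - t \<notin> \<int>\<^sub>\<le>\<^sub>0" if "x \<in> set b1" "t \<notin> P" for x t
  proof
    assume "1 - x - t \<in> \<int>\<^sub>\<le>\<^sub>0"
    then obtain k :: nat where k: "1 - x - t = - of_nat k" by (elim nonpos_Ints_cases')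
    obtain i where i: "i < length b1" "x = b1 ! i" using \<open>x \<in> set b1\<close> by (auto simp: in_set_conv_nth)
    have "t = pole (From_b i, k)" using k i by (simp add: pole_simps algebra_simps)
    thus False using that mem[of "From_b i" k] i by (auto simp: families_def)
  qed
  have 3: "- t \<notin> \<int>\<^sub>\<le>\<^sub>0" if "t \<notin> P" for t
  proof
    assume "- t \<in> \<int>\<^sub>\<le>\<^sub>0"
    then obtain k :: nat where k: "- t = - of_nat k" by (elim nonpos_Ints_cases')
    hence "t = pole (Nonneg, k)" by (simp add: pole_simps)
    thus False using that mem[of Nonneg k] by (auto simp: families_def)
  qed
  have 4: "1 + t \<notin> \<int>\<^sub>\<le>\<^sub>0" if "t \<notin> P" for t
  proof
    assume "1 + t \<in> \<int>\<^sub>\<le>\<^sub>0"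
    then obtain k :: nat where k: "1 + t = - of_nat k" by (elim nonpos_Ints_cases')
    hence "t = pole (Negative, k)" by (simp add: pole_simps algebra_simps eq_neg_iff_add_eq_0)
    thus False using that mem[of Negative k] by (auto simp: families_def)
  qed
  have "(\<lambda>t. G t) analytic_on - P"
    unfolding barnes_integrand_def by (intro analytic_intros) (auto simp: 1 2 3 4)
  thus ?thesis unfolding P_def by (intro analytic_imp_holomorphic) auto
qed

lemma barnes_contour:
  obtains \<theta> C \<alpha> where "0 < \<theta>" "\<theta> < 1" "C \<ge> 0" "\<alpha> < -1"
    "\<And>j. j \<in> families \<Longrightarrow> \<theta> - Re (center j) \<notin> \<int>"
    "eventually (\<lambda>N. \<forall>t\<in>path_image (rect \<theta> N). norm (G t) \<le> C * real N powr \<alpha>) sequentially"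
proof -
  \<comment> \<open>One finite set serves twice: for the lower bounds on the sines, and because
    modulo 1 its real parts are those of the negated pole centers, which \<open>\<theta>\<close> has
    to avoid.\<close>
  define S where "S = {0, 1} \<union> set a2 \<union> set b1"
  have "finite S" by (simp add: S_def)
  define \<alpha> where "\<alpha> = Re (sum_list a - sum_list b) - 1"
  have \<alpha>: "\<alpha> < -1" using Re_pos by (simp add: \<alpha>_def)
  obtain \<theta> where \<theta>: "0 < \<theta>" "\<theta> < 1" "\<And>x. x \<in> Re ` S \<Longrightarrow> x + \<theta> \<notin> \<int>"
    using exists_avoiding_Ints[of "Re ` S"] by (auto simp: S_def)
  obtain \<kappa> where \<kappa>: "\<kappa> > 0" "eventually (\<lambda>N. path_image (rect \<theta> N) \<subseteq> sine_region S \<kappa>) sequentially"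
    using rect_sine_region[of S \<theta>] \<theta>(3) \<open>finite S\<close> by blast
  obtain C K where CK: "C > 0" "\<And>t. t \<in> sine_region S \<kappa> \<Longrightarrow> norm t \<ge> K \<Longrightarrow> norm (G t) \<le> C * norm t powr \<alpha>"
    using barnes_integrand_decay[OF \<kappa>(1), of a2 b1 S a1 b2] length_eq length_le unfolding \<alpha>_def S_def by blast
  show ?thesis
  proof (rule that)
    show "\<theta> - Re (center j) \<notin> \<int>" if j: "j \<in> families" for j
    proof -
      have neg: "x + \<theta> \<notin> \<int> \<Longrightarrow> \<theta> - (1 - x) \<notin> \<int>" for x
        using Ints_add[of "\<theta> - (1 - x)" 1] by (auto simp: add.commute)
      consider "j = Nonneg" | "j = Negative" | i where "j = From_a i" "i < length a2" | i where "j = From_b i" "i < length b1"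
        using j by (auto simp: families_def)
      thus ?thesis
      proof cases
        case 1
        thus ?thesis using \<theta>(3)[of 0] by (simp add: center_def S_def)
      next
        case 2
        thus ?thesis using \<theta>(3)[of 1] by (simp add: center_def S_def add.commute)
      next
        case 3
        thus ?thesis using \<theta>(3)[of "Re (a2 ! i)"] by (simp add: center_def S_def add.commute)
      next
        case 4
        hence "Re (b1 ! i) + \<theta> \<notin> \<int>" by (intro \<theta>(3)) (auto simp: S_def)
        from neg[OF this] show ?thesis using 4 by (simp add: center_def)
      qed
    qed
    \<comment> \<open>On the rectangle |t| >= N - 1, so this threshold gives |t| >= K and |t| >=
      N/2. Since the exponent is negative, the latter is the origin of the factor (1/2) powr
      \<open>\<alpha>\<close>.\<close>
    have "eventually (\<lambda>N. real N \<ge> max 2 (K + 1)) sequentially"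
      by (rule filterlim_real_sequentially[unfolded filterlim_at_top, rule_format])
    with \<kappa>(2) show "eventually (\<lambda>N. \<forall>t\<in>path_image (rect \<theta> N). norm (G t) \<le> C * (1/2) powr \<alpha> * real N powr \<alpha>) sequentially"
    proof eventually_elim
      case (elim N)
      show ?case
      proof
        fix t assume t: "t \<in> path_image (rect \<theta> N)"
        hence "Re t = \<theta> - real N \<or> Re t = \<theta> + real N \<or> \<bar>Im t\<bar> = real N"
          using path_image_rect by blast
        hence "norm t \<ge> real N - 1"
          using abs_Re_le_cmod[of t] abs_Im_le_cmod[of t] \<theta>(1,2) elim(2) by fastforce
        hence n: "norm t \<ge> K" "norm t \<ge> 1 / 2 * real N" using elim(2) by linarith+
        hence "norm (G t) \<le> C * norm t powr \<alpha>" using elim(1) t by (intro CK) auto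
        also have "norm t powr \<alpha> \<le> (1 / 2 * real N) powr \<alpha>"
          using n(2) elim(2) \<alpha> by (intro powr_mono2') auto
        hence "C * norm t powr \<alpha> \<le> C * (1 / 2 * real N) powr \<alpha>"
          using CK(1) by (intro mult_left_mono) auto
        also have "\<dots> = C * (1/2) powr \<alpha> * real N powr \<alpha>"
          by (simp only: powr_mult mult.assoc)
        finally show "norm (G t) \<le> C * (1/2) powr \<alpha> * real N powr \<alpha>" .
      qed
    qed
  qed (use \<theta> \<alpha> CK in auto)
qed

section \<open>Convergence of the residue series and assembly of the formula\<close>

lemma norm_z: "norm z \<le> 1"
  by (simp add: z_def norm_power)

lemma hypF_sums:
  assumes "length as = Suc (length bs)" "Re (sum_list bs - sum_list as) > 0"
    and "\<forall>x\<in>set bs. x \<notin> \<int>\<^sub>\<le>\<^sub>0"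
  shows "(\<lambda>k. pochL as k / pochL bs k * z ^ k / of_nat (fact k)) sums hypF as bs z"
  unfolding hypF_def using summable_hypF[OF assms norm_z] by (rule summable_sums)

text \<open>In each of these series the lower minus the upper parameter sum is again sum b - sum a,
  because the constant shifts cancel by \<open>length_eq\<close>. Hence \<open>Re_pos\<close> alone
  yields every excess condition for convergence on the unit circle.\<close>

lemma residue_sums:
  shows "(\<lambda>k. residue G (pole (Negative, k))) sums
      - (D * (z * pochL (map (\<lambda>x. 1 - x) b) 1 / pochL (map (\<lambda>x. 1 - x) a) 1)
         * hypF ([1, 1] @ map (\<lambda>x. 2 - x) b) (map (\<lambda>x. 2 - x) a) z)"
    and "i < length a2 \<Longrightarrow> (\<lambda>k. residue G (pole (From_a i, k))) sums
      (of_real pi * coeff_a i * hypF (a2 ! i # map (\<lambda>x. 1 - x + a2 ! i) b) (map (\<lambda>x. 1 - x + a2 ! i) (a1 @ del_nth i a2)) z)"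
    and "i < length b1 \<Longrightarrow> (\<lambda>k. residue G (pole (From_b i, k))) sums
      (of_real pi * coeff_b i * hypF (map (\<lambda>x. 1 - b1 ! i + x) a) ((2 - b1 ! i) # map (\<lambda>x. 1 - b1 ! i + x) (del_nth i b1 @ b2)) z)"
proof -
  have len: "of_nat (length a1) + of_nat (length a2) = (1 + of_nat (length b1) + of_nat (length b2) :: complex)"
    using length_eq by (metis of_nat_Suc of_nat_add add.assoc)
  have "(\<lambda>k. - (D * (z * pochL (map (\<lambda>x. 1 - x) b) 1 / pochL (map (\<lambda>x. 1 - x) a) 1)) *
     (pochL ([1, 1] @ map (\<lambda>x. 2 - x) b) k / pochL (map (\<lambda>x. 2 - x) a) k * z ^ k / of_nat (fact k)))
     sums (- (D * (z * pochL (map (\<lambda>x. 1 - x) b) 1 / pochL (map (\<lambda>x. 1 - x) a) 1))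
         * hypF ([1, 1] @ map (\<lambda>x. 2 - x) b) (map (\<lambda>x. 2 - x) a) z)"
  proof (intro sums_mult hypF_sums)
    have "sum_list (map (\<lambda>x. 2 - x) a) - sum_list ([1, 1] @ map (\<lambda>x. 2 - x) b) = 
       2 * (of_nat (length a1) + of_nat (length a2)) - 2 - 2 * (of_nat (length b1) + of_nat (length b2)) + (sum_list b - sum_list a)"
      unfolding map_append sum_list_append sum_list_map_affine by (simp add: algebra_simps)
    also have "\<dots> = sum_list b - sum_list a" unfolding len by (simp add: algebra_simps)
    finally show "Re (sum_list (map (\<lambda>x. 2 - x) a) - sum_list ([1, 1] @ map (\<lambda>x. 2 - x) b)) > 0"
      using Re_pos by (simp only:)
    show "\<forall>x\<in>set (map (\<lambda>x. 2 - x) a). x \<notin> \<int>\<^sub>\<le>\<^sub>0"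
      using a1_nonint a2_nonint by (auto intro!: notin_nonpos_IntsI simp: Ints_shift)
  qed (use length_eq in simp)
  thus "(\<lambda>k. residue G (pole (Negative, k))) sums
      - (D * (z * pochL (map (\<lambda>x. 1 - x) b) 1 / pochL (map (\<lambda>x. 1 - x) a) 1)
         * hypF ([1, 1] @ map (\<lambda>x. 2 - x) b) (map (\<lambda>x. 2 - x) a) z)"
    unfolding residue_negative[symmetric] by (simp add: pole_simps)
  show "(\<lambda>k. residue G (pole (From_a i, k))) sums
      (of_real pi * coeff_a i * hypF (a2 ! i # map (\<lambda>x. 1 - x + a2 ! i) b) (map (\<lambda>x. 1 - x + a2 ! i) (a1 @ del_nth i a2)) z)"
    if i: "i < length a2"
  proof -
    define ak where "ak = a2 ! i"
    have l: "of_nat (length (del_nth i a2)) = (of_nat (length a2) - 1 :: complex)"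
      unfolding length_del_nth[OF i, symmetric] by simp
    have "(\<lambda>k. of_real pi * coeff_a i *
     (pochL (ak # map (\<lambda>x. 1 - x + ak) b) k / pochL (map (\<lambda>x. 1 - x + ak) (a1 @ del_nth i a2)) k * z ^ k / of_nat (fact k)))
      sums (of_real pi * coeff_a i * hypF (ak # map (\<lambda>x. 1 - x + ak) b) (map (\<lambda>x. 1 - x + ak) (a1 @ del_nth i a2)) z)"
    proof (intro sums_mult hypF_sums)
      have "sum_list (map (\<lambda>x. 1 - x + ak) (a1 @ del_nth i a2)) - sum_list (ak # map (\<lambda>x. 1 - x + ak) b) = 
        (of_nat (length a1) + of_nat (length a2) - 1 - of_nat (length b1) - of_nat (length b2)) * (1 + ak) + (sum_list b - sum_list a)"
        unfolding map_append sum_list_append sum_list.Cons sum_list_map_affine sum_list_del_nth[OF i] l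
        by (simp add: ak_def algebra_simps)
      also have "\<dots> = sum_list b - sum_list a" unfolding len by (simp add: algebra_simps)
      finally show "Re (sum_list (map (\<lambda>x. 1 - x + ak) (a1 @ del_nth i a2)) - sum_list (ak # map (\<lambda>x. 1 - x + ak) b)) > 0"
        using Re_pos by (simp only:)
      show "\<forall>x\<in>set (map (\<lambda>x. 1 - x + ak) (a1 @ del_nth i a2)). x \<notin> \<int>\<^sub>\<le>\<^sub>0"
      proof -
        have "1 - x + ak \<notin> \<int>\<^sub>\<le>\<^sub>0" if x: "x \<in> set (del_nth i a2)" for x
        proof -
          from x obtain j where "j < length a2" "j \<noteq> i" "x = a2 ! j" by (rule in_set_del_nth)
          hence "ak - x \<notin> \<int>" using a2_distinct i by (auto simp: ak_def)
          hence "ak - x + of_nat 1 \<notin> \<int>" by (subst Ints_shift(2))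
          thus ?thesis by (intro notin_nonpos_IntsI) (simp add: algebra_simps)
        qed
        thus ?thesis using a2k_gen i by (auto simp: ak_def)
      qed
    qed (use length_eq length_del_nth[OF i] in simp)
    thus ?thesis unfolding ak_def residue_a[OF i, symmetric] by (simp add: pole_simps)
  qed
  show "(\<lambda>k. residue G (pole (From_b i, k))) sums
      (of_real pi * coeff_b i * hypF (map (\<lambda>x. 1 - b1 ! i + x) a) ((2 - b1 ! i) # map (\<lambda>x. 1 - b1 ! i + x) (del_nth i b1 @ b2)) z)"
    if i: "i < length b1"
  proof -
    define bk where "bk = b1 ! i"
    have l: "of_nat (length (del_nth i b1)) = (of_nat (length b1) - 1 :: complex)"
      unfolding length_del_nth[OF i, symmetric] by simp
    have "(\<lambda>k. of_real pi * coeff_b i *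
     (pochL (map (\<lambda>x. 1 - bk + x) a) k / pochL ((2 - bk) # map (\<lambda>x. 1 - bk + x) (del_nth i b1 @ b2)) k * z ^ k / of_nat (fact k)))
      sums (of_real pi * coeff_b i * hypF (map (\<lambda>x. 1 - bk + x) a) ((2 - bk) # map (\<lambda>x. 1 - bk + x) (del_nth i b1 @ b2)) z)"
    proof (intro sums_mult hypF_sums)
      have "sum_list ((2 - bk) # map (\<lambda>x. 1 - bk + x) (del_nth i b1 @ b2)) - sum_list (map (\<lambda>x. 1 - bk + x) a) = 
        (1 + of_nat (length b1) + of_nat (length b2) - (of_nat (length a1) + of_nat (length a2))) * (1 - bk) + (sum_list b - sum_list a)"
        unfolding map_append sum_list_append sum_list.Cons sum_list_map_affine sum_list_del_nth[OF i] l
        by (simp add: bk_def algebra_simps)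
      also have "\<dots> = sum_list b - sum_list a" unfolding len by simp
      finally show "Re (sum_list ((2 - bk) # map (\<lambda>x. 1 - bk + x) (del_nth i b1 @ b2)) - sum_list (map (\<lambda>x. 1 - bk + x) a)) > 0"
        using Re_pos by (simp only:)
      show "\<forall>x\<in>set ((2 - bk) # map (\<lambda>x. 1 - bk + x) (del_nth i b1 @ b2)). x \<notin> \<int>\<^sub>\<le>\<^sub>0"
      proof -
        have "1 - bk + x \<notin> \<int>\<^sub>\<le>\<^sub>0" if x: "x \<in> set (del_nth i b1)" for x
        proof -
          from x obtain j where "j < length b1" "j \<noteq> i" "x = b1 ! j" by (rule in_set_del_nth)
          hence "x - bk \<notin> \<int>" using b1_distinct i by (auto simp: bk_def)
          hence "x - bk + of_nat 1 \<notin> \<int>" by (subst Ints_shift(2))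
          thus ?thesis by (intro notin_nonpos_IntsI) (simp add: algebra_simps)
        qed
        moreover have "2 - bk \<notin> \<int>\<^sub>\<le>\<^sub>0"
          using b1_nonint i by (intro notin_nonpos_IntsI) (simp add: Ints_shift bk_def)
        ultimately show ?thesis using b1k_gen i by (auto simp: bk_def)
      qed
    qed (use length_eq length_del_nth[OF i] in simp)
    thus ?thesis unfolding bk_def residue_b[OF i, symmetric] by (simp add: pole_simps)
  qed
qed

text \<open>By \<open>residue_nonneg\<close> the digamma term equals the cotangent factor times the
  hypergeometric term minus the residue divided by D pi. Both of these sum to known values, the
  residues to minus the sum over the other three families.\<close>

lemma digamma_series_sums:
  "(\<lambda>k. pochL a k * z ^ k / (complex_of_real pi * pochL b k * of_nat (fact k)) *
            ((\<Sum>x\<leftarrow>b. Digamma (x + of_nat k)) + Digamma (1 + of_nat k)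
             - (\<Sum>x\<leftarrow>a. Digamma (x + of_nat k))))
    sums
     (((\<Sum>x\<leftarrow>a1. cot (complex_of_real pi * x)) - (\<Sum>x\<leftarrow>b1. cot (complex_of_real pi * x))) * hypF a b z
       - z * pochL (map (\<lambda>x. 1 - x) b) 1 / (complex_of_real pi * pochL (map (\<lambda>x. 1 - x) a) 1)
         * hypF ([1, 1] @ map (\<lambda>x. 2 - x) b) (map (\<lambda>x. 2 - x) a) z
       + inverse D * (\<Sum>i<length a2. coeff_a i * 
           hypF (a2 ! i # map (\<lambda>x. 1 - x + a2 ! i) b) (map (\<lambda>x. 1 - x + a2 ! i) (a1 @ del_nth i a2)) z)
       + inverse D * (\<Sum>i<length b1. coeff_b i *
           hypF (map (\<lambda>x. 1 - b1 ! i + x) a) ((2 - b1 ! i) # map (\<lambda>x. 1 - b1 ! i + x) (del_nth i b1 @ b2)) z))"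
proof -
  define FA where "FA = (\<lambda>i. hypF (a2 ! i # map (\<lambda>x. 1 - x + a2 ! i) b) (map (\<lambda>x. 1 - x + a2 ! i) (a1 @ del_nth i a2)) z)"
  define FB where "FB = (\<lambda>i. hypF (map (\<lambda>x. 1 - b1 ! i + x) a) ((2 - b1 ! i) # map (\<lambda>x. 1 - b1 ! i + x) (del_nth i b1 @ b2)) z)"
  define FN where "FN = z * pochL (map (\<lambda>x. 1 - x) b) 1 / pochL (map (\<lambda>x. 1 - x) a) 1 * hypF ([1, 1] @ map (\<lambda>x. 2 - x) b) (map (\<lambda>x. 2 - x) a) z"
  define ct where "ct = (\<Sum>x\<leftarrow>a1. cot (complex_of_real pi * x)) - (\<Sum>x\<leftarrow>b1. cot (complex_of_real pi * x))"
  define T where "T = (\<lambda>k. pochL a k / pochL b k * z ^ k / of_nat (fact k))"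
  define Br where "Br = (\<lambda>k. (\<Sum>x\<leftarrow>b. Digamma (x + of_nat k)) + Digamma (1 + of_nat k) - (\<Sum>x\<leftarrow>a. Digamma (x + of_nat k)))"
  obtain \<theta> C \<alpha> where c: "0 < \<theta>" "\<theta> < 1" "C \<ge> 0" "\<alpha> < -1"
    "\<And>j. j \<in> families \<Longrightarrow> \<theta> - Re (center j) \<notin> \<int>"
    "eventually (\<lambda>N. \<forall>t\<in>path_image (rect \<theta> N). norm (G t) \<le> C * real N powr \<alpha>) sequentially"
    using barnes_contour by blast
  have others: "families - {Nonneg} = {Negative} \<union> From_a ` {..<length a2} \<union> From_b ` {..<length b1}"
    by (auto simp: families_def)
  have "(\<lambda>k. residue G (of_nat k)) sums (- (\<Sum>j\<in>families-{Nonneg}. \<Sum>k. residue G (center j + direction j * of_nat k)))"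
  proof (rule residue_series_sums[OF _ _ inj_on_pole[unfolded pole_def] holomorphic_G[unfolded pole_def] c(5,6,4,3)])
    show "finite families" by (simp add: families_def)
    show "direction j = 1 \<or> direction j = - 1" if "j \<in> families" for j
      by (cases j) (auto simp: direction_def)
    show "Nonneg \<in> families" "center Nonneg = 0" "direction Nonneg = 1"
      by (simp_all add: families_def center_def direction_def)
    show "summable (\<lambda>k. residue G (center j + direction j * of_nat k))" if "j \<in> families - {Nonneg}" for j
      using that residue_sums[THEN sums_summable] unfolding others by (auto simp: pole_def)
  qed (use c in auto)
  also have "(\<Sum>j\<in>families-{Nonneg}. \<Sum>k. residue G (center j + direction j * of_nat k)) =
     (\<Sum>k. residue G (pole (Negative, k))) + (\<Sum>i<length a2. \<Sum>k. residue G (pole (From_a i, k)))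
      + (\<Sum>i<length b1. \<Sum>k. residue G (pole (From_b i, k)))"
  proof -
    have "sum f ({Negative} \<union> From_a ` {..<m} \<union> From_b ` {..<n}) = f Negative + (\<Sum>i<m. f (From_a i)) + (\<Sum>i<n. f (From_b i))"
      for f :: "pole_family \<Rightarrow> complex" and m n
    proof -
      have "sum f ({Negative} \<union> From_a ` {..<m} \<union> From_b ` {..<n}) = 
          sum f ({Negative} \<union> From_a ` {..<m}) + sum f (From_b ` {..<n})"
        by (intro sum.union_disjoint) auto
      also have "sum f ({Negative} \<union> From_a ` {..<m}) = sum f {Negative} + sum f (From_a ` {..<m})"
        by (intro sum.union_disjoint) auto
      finally show ?thesis by (simp add: sum.reindex inj_on_def)
    qed
    thus ?thesis unfolding others by (simp add: pole_def)
  qed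
  also have "(\<Sum>k. residue G (pole (Negative, k))) = - (D * FN)"
    unfolding residue_sums(1)[THEN sums_unique, symmetric] FN_def by (simp only: mult.assoc)
  also have "(\<Sum>i<length a2. \<Sum>k. residue G (pole (From_a i, k))) = (\<Sum>i<length a2. of_real pi * coeff_a i * FA i)"
    unfolding FA_def by (intro sum.cong refl residue_sums(2)[THEN sums_unique, symmetric]) simp
  also have "(\<Sum>i<length b1. \<Sum>k. residue G (pole (From_b i, k))) = (\<Sum>i<length b1. of_real pi * coeff_b i * FB i)"
    unfolding FB_def by (intro sum.cong refl residue_sums(3)[THEN sums_unique, symmetric]) simp
  finally have res: "(\<lambda>k. residue G (of_nat k)) sums
     (- (- (D * FN) + (\<Sum>i<length a2. of_real pi * coeff_a i * FA i) + (\<Sum>i<length b1. of_real pi * coeff_b i * FB i)))" .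
  have "T sums hypF a b z"
    unfolding T_def
  proof (rule hypF_sums)
    show "\<forall>x\<in>set b. x \<notin> \<int>\<^sub>\<le>\<^sub>0" using b1_nonint b2_gen by (auto dest: notin_nonpos_IntsI)
  qed (use length_eq Re_pos in auto)
  hence "(\<lambda>k. ct * T k - residue G (of_nat k) * inverse (D * of_real pi)) sums
    (ct * hypF a b z - (- (- (D * FN) + (\<Sum>i<length a2. of_real pi * coeff_a i * FA i) + (\<Sum>i<length b1. of_real pi * coeff_b i * FB i)))
      * inverse (D * of_real pi))"
    by (intro sums_diff sums_mult sums_mult2 res)
  also have "(\<lambda>k. ct * T k - residue G (of_nat k) * inverse (D * of_real pi)) = (\<lambda>k. T k / of_real pi * Br k)"
  proof
    fix k
    have r: "residue G (of_nat k) = D * T k * (of_real pi * ct - Br k)"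
      unfolding T_def Br_def ct_def by (rule residue_nonneg)
    show "ct * T k - residue G (of_nat k) * inverse (D * of_real pi) = T k / of_real pi * Br k"
      unfolding r using D_nonzero by (simp add: field_simps)
  qed
  also have "ct * hypF a b z - (- (- (D * FN) + (\<Sum>i<length a2. of_real pi * coeff_a i * FA i) + (\<Sum>i<length b1. of_real pi * coeff_b i * FB i)))
      * inverse (D * of_real pi) = 
     ct * hypF a b z - FN / of_real pi + inverse D * (\<Sum>i<length a2. coeff_a i * FA i) + inverse D * (\<Sum>i<length b1. coeff_b i * FB i)"
  proof -
    have "w - (- (- (D * f) + p * A + p * B)) * inverse (D * p) = w - f / p + inverse D * A + inverse D * B"
      if "p \<noteq> 0" for w f p A B :: complex
      using that D_nonzero by (simp add: field_simps)
    from this[of "of_real pi" "ct * hypF a b z" FN "\<Sum>i<length a2. coeff_a i * FA i" "\<Sum>i<length b1. coeff_b i * FB i"]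
    show ?thesis by (simp add: sum_distrib_left mult.assoc)
  qed
  finally show ?thesis
    unfolding T_def Br_def ct_def FN_def FA_def FB_def by (simp add: divide_inverse mult_ac)
qed

end

text \<open>Only the parity of the exponent matters, and s - n and n + s have the same one.\<close>

lemma minus_one_powi_diff: "(-1 :: complex) powi (int s - int n) = (-1) ^ (n + s)"
proof -
  have "(-1 :: complex) powi (int s - int n) = (-1) ^ s / (-1) ^ n"
    by (simp add: power_int_diff)
  also have "\<dots> = (-1) ^ s * (-1) ^ n"
    by (simp add: divide_inverse flip: power_inverse)
  finally show ?thesis by (simp add: power_add mult.commute)
qed

theorem mainTheorem5:
  fixes p n s :: nat and a1 a2 b1 b2 :: "complex list"
  assumes "p \<ge> 1" and "n \<le> p" and "s \<le> p - 1" and "int s - int n \<ge> -2"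
    and "length a1 = n" and "length a2 = p - n"
    and "length b1 = s" and "length b2 = p - 1 - s"
    and a1_nonint: "\<forall>x\<in>set a1. x \<notin> \<int>"
    and b1_nonint: "\<forall>x\<in>set b1. x \<notin> \<int>"
    and Re_pos: "Re (sum_list (b1 @ b2) - sum_list (a1 @ a2)) > 0"
    and a2_nonint: "\<forall>x\<in>set a2. x \<notin> \<int>"
    and a2_distinct: "\<forall>i<length a2. \<forall>j<length a2. i \<noteq> j \<longrightarrow> a2 ! i - a2 ! j \<notin> \<int>"
    and b1_distinct: "\<forall>i<length b1. \<forall>j<length b1. i \<noteq> j \<longrightarrow> b1 ! i - b1 ! j \<notin> \<int>"
    and b2_gen: "\<forall>x\<in>set b2. x \<notin> \<int>\<^sub>\<le>\<^sub>0"
    and a2k_gen: "\<forall>i<length a2.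
         (\<forall>x\<in>set b1. 1 - x + a2 ! i \<notin> \<int>\<^sub>\<le>\<^sub>0) \<and>
         (\<forall>x\<in>set b2. x - a2 ! i \<notin> \<int>\<^sub>\<le>\<^sub>0) \<and>
         (\<forall>x\<in>set a1. 1 - x + a2 ! i \<notin> \<int>\<^sub>\<le>\<^sub>0)"
    and b1k_gen: "\<forall>i<length b1.
         (\<forall>x\<in>set a2. 1 - b1 ! i + x \<notin> \<int>\<^sub>\<le>\<^sub>0) \<and>
         (\<forall>x\<in>set a1. b1 ! i - x \<notin> \<int>\<^sub>\<le>\<^sub>0) \<and>
         (\<forall>x\<in>set b2. 1 - b1 ! i + x \<notin> \<int>\<^sub>\<le>\<^sub>0)"
  defines "a \<equiv> a1 @ a2" and "b \<equiv> b1 @ b2"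
    and "z \<equiv> (-1::complex) powi (int s - int n)"
  shows "(\<lambda>k. pochL a k * z ^ k / (complex_of_real pi * pochL b k * of_nat (fact k)) *
            ((\<Sum>x\<leftarrow>b. Digamma (x + of_nat k)) + Digamma (1 + of_nat k)
             - (\<Sum>x\<leftarrow>a. Digamma (x + of_nat k))))
    sums
     ( ((\<Sum>x\<leftarrow>a1. cot (complex_of_real pi * x)) - (\<Sum>x\<leftarrow>b1. cot (complex_of_real pi * x)))
         * hypF a b z
       - z * pochL (map (\<lambda>x. 1 - x) b) 1 / (complex_of_real pi * pochL (map (\<lambda>x. 1 - x) a) 1)
         * hypF ([1, 1] @ map (\<lambda>x. 2 - x) b) (map (\<lambda>x. 2 - x) a) z
       + GammaL (map (\<lambda>x. 1 - x) a1) * GammaL b2 / (GammaL (map (\<lambda>x. 1 - x) b1) * GammaL a2)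
         * (\<Sum>i<length a2. let ak = a2 ! i in
              Gamma ak * GammaL (map (\<lambda>x. x - ak) (del_nth i a2))
                * GammaL (map (\<lambda>x. 1 - x + ak) b1)
              / (sin (complex_of_real pi * ak) * GammaL (map (\<lambda>x. x - ak) b2)
                 * GammaL (map (\<lambda>x. 1 - x + ak) a1))
              * hypF (ak # map (\<lambda>x. 1 - x + ak) b) (map (\<lambda>x. 1 - x + ak) (a1 @ del_nth i a2)) z)
       + GammaL (map (\<lambda>x. 1 - x) a1) * GammaL b2 / (GammaL (map (\<lambda>x. 1 - x) b1) * GammaL a2)
         * (\<Sum>i<length b1. let bk = b1 ! i in
              Gamma (bk - 1) * GammaL (map (\<lambda>x. bk - x) (del_nth i b1))
                * GammaL (map (\<lambda>x. 1 - bk + x) a2)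
              / (sin (complex_of_real pi * bk) * GammaL (map (\<lambda>x. bk - x) a1)
                 * GammaL (map (\<lambda>x. 1 - bk + x) b2))
              * hypF (map (\<lambda>x. 1 - bk + x) a) ((2 - bk) # map (\<lambda>x. 1 - bk + x) (del_nth i b1 @ b2)) z) )"
proof -
  interpret B: barnes_data a1 a2 b1 b2
  proof
    show "length a1 + length a2 = Suc (length b1 + length b2)" "length a1 \<le> length b1 + 2"
      using assms(1-8) by linarith+
  qed fact+
  have z: "z = B.z"
    unfolding z_def B.z_def minus_one_powi_diff using assms(5,7) by simp
  have D: "GammaL (map (\<lambda>x. 1 - x) a1) * GammaL b2 / (GammaL (map (\<lambda>x. 1 - x) b1) * GammaL a2) = inverse B.D"
    by (simp add: B.D_def mult.commute)
  show ?thesis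
    using B.digamma_series_sums unfolding z D a_def b_def B.coeff_a_def B.coeff_b_def Let_def .
qed

end
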